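(* Let $\tilde F\in C^3(\mathbb{R})$ be real-valued and let $u\in C^4([0,T]\times[0,L])$ be a solution of $$\frac{\partial^2u}{\partial t^2}=\frac{\partial^2u}{\partial x^2}-\tilde F'(u),\quad(t,x)\in(0,T)\times(0,L),$$ $$\frac{\partial^2u}{\partial t^2}(t,0)-\frac{\partial u}{\partial x}(t,0)=0,\qquad\frac{\partial^2u}{\partial t^2}(t,L)+\frac{\partial u}{\partial x}(t,L)=0,\quad t\in(0,T),$$ with initial data $u(0,x)\in C^4([0,L])$ and $\partial_tu(0,x)\in C^3([0,L])$. Let $\boldsymbol U^{(n)}$ be the solution of the difference scheme $$\delta_n^{\langle2\rangle}U_k^{(n)}=\delta_k^{\langle2\rangle}\left(\frac{U_k^{(n+1)}+U_k^{(n-1)}}{2}\right)-\frac{d\tilde F}{d(U_k^{(n+1)},U_k^{(n-1)})}\qquad(k=0,\ldots,K),$$ $$\delta_n^{\langle2\rangle}U_0^{(n)}-\delta_k^{\langle1\rangle}\left(\frac{U_0^{(n+1)}+U_0^{(n-1)}}{2}\right)=0,\qquad \delta_n^{\langle2\rangle}U_K^{(n)}+\delta_k^{\langle1\rangle}\left(\frac{U_K^{(n+1)}+U_K^{(n-1)}}{2}\right)=0$$ ($n=1,\ldots,N-1$), with initial data $\boldsymbol U^{(0)}=\boldsymbol u^{(0)}$ and $\boldsymbol U^{(1)}=\boldsymbol u^{(1)}$. Let $C_1:=\max_{n=0,1,\ldots,N}\max\{\|\boldsymbol U^{(n)}\|_\infty,\|\boldsymbol u^{(n)}\|_\infty\}$,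 and fix a constant $B$ satisfying $B<1/(1+C_{\tilde F''}(C_1))$. Then for $\Delta t<B$ we have $$\max_{n=1,2,\ldots,N}\left(\|\delta_n^-\boldsymbol e^{(n)}\|_2+\|\boldsymbol e^{(n)}\|_{H^1}+|\delta_n^-e_0^{(n)}|+|\delta_n^-e_K^{(n)}|\right)\le C\left((\Delta x)^2+(\Delta t)^2\right),$$ where the constant $C$ is independent of $\Delta x$ and $\Delta t$.
   Context: Let $L,T>0$, let $N,K$ be positive integers, $\Delta t=T/N$, $\Delta x=L/K$. The unknowns of the scheme are $U_k^{(n)}$, $k=-1,\ldots,K+1$, $n=0,\ldots,N$. Denote $u_k^{(n)}=u(n\Delta t,k\Delta x)$, $e_k^{(n)}=U_k^{(n)}-u_k^{(n)}$, with vector forms $\boldsymbol u^{(n)}=\{u_k^{(n)}\}_{k=0}^K$, $\boldsymbol e^{(n)}=\{e_k^{(n)}\}_{k=0}^K$; vector equalities and norms involve the components $k=0,\ldots,K$. For a family $f_k^{(n)}$ (time index $n$, space index $k$): $\delta_n^-f_k^{(n)}=\frac{f_k^{(n)}-f_k^{(n-1)}}{\Delta t}$, $\delta_k^+f_k^{(n)}=\frac{f_{k+1}^{(n)}-f_k^{(n)}}{\Delta x}$, $\delta_k^{\langle1\rangle}f_k^{(n)}=\frac{f_{k+1}^{(n)}-f_{k-1}^{(n)}}{2\Delta x}$, $\delta_n^{\langle2\rangle}f_k^{(n)}=\frac{f_k^{(n+1)}-2f_k^{(n)}+f_k^{(n-1)}}{(\Delta t)^2}$, $\delta_k^{\langle2\rangle}f_k^{(n)}=\frac{f_{k+1}^{(n)}-2f_k^{(n)}+f_{k-1}^{(n)}}{(\Delta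 x)^2}$. Two-point difference quotient: $\frac{d\tilde F}{d(a,b)}=\frac{\tilde F(a)-\tilde F(b)}{a-b}$ if $a\ne b$, and $\tilde F'(a)$ if $a=b$. For a continuous function $G$ on $\mathbb{R}$ and $\rho\ge0$, $C_G(\rho):=\max_{|\xi|\le\rho}|G(\xi)|$. Trapezoidal sum: $\sum_{k=0}^K{}''f_k\Delta x=\frac12f_0\Delta x+\sum_{k=1}^{K-1}f_k\Delta x+\frac12f_K\Delta x$. For $\boldsymbol U=\{U_k\}_{k=0}^K\in\mathbb{R}^{K+1}$: $\|\boldsymbol U\|_\infty=\max_{0\le k\le K}|U_k|$, $\|\boldsymbol U\|_2=\left(\sum_{k=0}^K{}''|U_k|^2\Delta x\right)^{1/2}$, $\|\boldsymbol U\|_{H^1}=\left(\sum_{k=0}^K{}''|U_k|^2\Delta x+\sum_{k=0}^{K-1}|\delta_k^+U_k|^2\Delta x\right)^{1/2}$. *)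

theory Defs
  imports "HOL-Analysis.Analysis"
begin

section \<open>Functions of class C^k\<close>

(* Derivatives are taken within S, hence one-sided at the end points of a compact interval.
   Only meant for sets without isolated points, where the derivative within S is unique. *)
primrec Ck_on :: "nat \<Rightarrow> real set \<Rightarrow> (real \<Rightarrow> real) \<Rightarrow> bool" where
  "Ck_on 0 S f \<longleftrightarrow> continuous_on S f"
| "Ck_on (Suc k) S f \<longleftrightarrow>
     f differentiable_on S \<and> Ck_on k S (\<lambda>x. vector_derivative f (at x within S))"

(* Partial derivatives of a function on the closed rectangle [0,T] x [0,L]: ordinary ones
   in the interior, one-sided ones in the direction normal to an edge. *)
definition pd_t :: "real \<Rightarrow> (real \<Rightarrow> real \<Rightarrow> real) \<Rightarrow> real \<Rightarrow> real \<Rightarrow> real" where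
  "pd_t T u = (\<lambda>t x. vector_derivative (\<lambda>s. u s x) (at t within {0..T}))"

definition pd_x :: "real \<Rightarrow> (real \<Rightarrow> real \<Rightarrow> real) \<Rightarrow> real \<Rightarrow> real \<Rightarrow> real" where
  "pd_x L u = (\<lambda>t x. vector_derivative (\<lambda>y. u t y) (at x within {0..L}))"

(* All partial derivatives of order at most k, mixed ones in any order of differentiation,
   exist and are continuous on [0,T] x [0,L]. *)
primrec Ck_rect :: "nat \<Rightarrow> real \<Rightarrow> real \<Rightarrow> (real \<Rightarrow> real \<Rightarrow> real) \<Rightarrow> bool" where
  "Ck_rect 0 T L u \<longleftrightarrow> continuous_on ({0..T} \<times> {0..L}) (\<lambda>(t, x). u t x)"
| "Ck_rect (Suc k) T L u \<longleftrightarrow>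
     continuous_on ({0..T} \<times> {0..L}) (\<lambda>(t, x). u t x) \<and>
     (\<forall>x\<in>{0..L}. (\<lambda>t. u t x) differentiable_on {0..T}) \<and>
     (\<forall>t\<in>{0..T}. (\<lambda>x. u t x) differentiable_on {0..L}) \<and>
     Ck_rect k T L (pd_t T u) \<and> Ck_rect k T L (pd_x L u)"

section \<open>The initial-boundary value problem\<close>

definition solves_ibvp ::
    "real \<Rightarrow> real \<Rightarrow> (real \<Rightarrow> real) \<Rightarrow> (real \<Rightarrow> real \<Rightarrow> real) \<Rightarrow> bool" where
  "solves_ibvp T L F u \<longleftrightarrow>
     (\<forall>t\<in>{0<..<T}. \<forall>x\<in>{0<..<L}.
        pd_t T (pd_t T u) t x = pd_x L (pd_x L u) t x - deriv F (u t x)) \<and>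
     (\<forall>t\<in>{0<..<T}. pd_t T (pd_t T u) t 0 - pd_x L u t 0 = 0) \<and>
     (\<forall>t\<in>{0<..<T}. pd_t T (pd_t T u) t L + pd_x L u t L = 0)"

section \<open>Difference operators\<close>

(* A family f_k^(n) is written f n k. The space index is an integer because of the ghost
   points k = -1 and k = K + 1. The time differences are only meant for n \<ge> 1, where the
   truncated subtraction n - 1 on nat is harmless. *)

definition dn_minus :: "real \<Rightarrow> (nat \<Rightarrow> int \<Rightarrow> real) \<Rightarrow> nat \<Rightarrow> int \<Rightarrow> real" where
  "dn_minus dt f n k = (f n k - f (n - 1) k) / dt"

definition dn_second :: "real \<Rightarrow> (nat \<Rightarrow> int \<Rightarrow> real) \<Rightarrow> nat \<Rightarrow> int \<Rightarrow> real" where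
  "dn_second dt f n k = (f (n + 1) k - 2 * f n k + f (n - 1) k) / dt\<^sup>2"

definition dk_plus :: "real \<Rightarrow> (int \<Rightarrow> real) \<Rightarrow> int \<Rightarrow> real" where
  "dk_plus dx f k = (f (k + 1) - f k) / dx"

definition dk_first :: "real \<Rightarrow> (int \<Rightarrow> real) \<Rightarrow> int \<Rightarrow> real" where
  "dk_first dx f k = (f (k + 1) - f (k - 1)) / (2 * dx)"

definition dk_second :: "real \<Rightarrow> (int \<Rightarrow> real) \<Rightarrow> int \<Rightarrow> real" where
  "dk_second dx f k = (f (k + 1) - 2 * f k + f (k - 1)) / dx\<^sup>2"

definition diff_quot :: "(real \<Rightarrow> real) \<Rightarrow> real \<Rightarrow> real \<Rightarrow> real" where
  "diff_quot F a b = (if a \<noteq> b then (F a - F b) / (a - b) else deriv F a)"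

section \<open>Norms\<close>

(* C_G(rho); for continuous G and rho \<ge> 0 the supremum is a maximum. *)
definition maxabs :: "(real \<Rightarrow> real) \<Rightarrow> real \<Rightarrow> real" where
  "maxabs G \<rho> = (SUP \<xi>\<in>{\<xi>. \<bar>\<xi>\<bar> \<le> \<rho>}. \<bar>G \<xi>\<bar>)"

definition trapez :: "real \<Rightarrow> nat \<Rightarrow> (int \<Rightarrow> real) \<Rightarrow> real" where
  "trapez dx K f = 1/2 * f 0 * dx + (\<Sum>k = 1..int K - 1. f k * dx) + 1/2 * f (int K) * dx"

definition norm_inf :: "nat \<Rightarrow> (int \<Rightarrow> real) \<Rightarrow> real" where
  "norm_inf K V = Max ((\<lambda>k. \<bar>V k\<bar>) ` {0..int K})"

definition norm_2 :: "real \<Rightarrow> nat \<Rightarrow> (int \<Rightarrow> real) \<Rightarrow> real" where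
  "norm_2 dx K V = sqrt (trapez dx K (\<lambda>k. \<bar>V k\<bar>\<^sup>2))"

definition norm_H1 :: "real \<Rightarrow> nat \<Rightarrow> (int \<Rightarrow> real) \<Rightarrow> real" where
  "norm_H1 dx K V =
     sqrt (trapez dx K (\<lambda>k. \<bar>V k\<bar>\<^sup>2) + (\<Sum>k = 0..int K - 1. \<bar>dk_plus dx V k\<bar>\<^sup>2 * dx))"

section \<open>The difference scheme\<close>

(* u_k^(n); only used for 0 \<le> k \<le> K, where the grid point lies in the domain of u. *)
definition grid :: "real \<Rightarrow> real \<Rightarrow> (real \<Rightarrow> real \<Rightarrow> real) \<Rightarrow> nat \<Rightarrow> int \<Rightarrow> real" where
  "grid dt dx u n k = u (real n * dt) (real_of_int k * dx)"

definition time_avg :: "(nat \<Rightarrow> int \<Rightarrow> real) \<Rightarrow> nat \<Rightarrow> int \<Rightarrow> real" where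
  "time_avg U n k = (U (n + 1) k + U (n - 1) k) / 2"

definition solves_scheme ::
    "real \<Rightarrow> real \<Rightarrow> nat \<Rightarrow> nat \<Rightarrow> (real \<Rightarrow> real) \<Rightarrow> (nat \<Rightarrow> int \<Rightarrow> real) \<Rightarrow> bool" where
  "solves_scheme dt dx N K F U \<longleftrightarrow>
     (\<forall>n\<in>{1..<N}.
        (\<forall>k\<in>{0..int K}.
           dn_second dt U n k =
             dk_second dx (time_avg U n) k - diff_quot F (U (n + 1) k) (U (n - 1) k)) \<and>
        dn_second dt U n 0 - dk_first dx (time_avg U n) 0 = 0 \<and>
        dn_second dt U n (int K) + dk_first dx (time_avg U n) (int K) = 0)"

end

theory Submission
  imports Defs
begin

text \<open>Once the ghost points are eliminated, the error solves a discrete wave equation with a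
  point mass at each wall. Its source consists of the truncation error, of second order also at the
  walls because the equation holds up to the boundary, and of a difference of the difference quotients
  of \<open>F\<close>, which is Lipschitz in the error. Testing with \<open>e (n + 1) - e (n - 1)\<close> and adding the squared
  error itself to the energy gives an implicit energy inequality; \<open>dt < B\<close> makes it solvable for the
  new energy, and a discrete Gronwall argument concludes. Since \<open>B\<close> bounds \<open>F''\<close> on the range of the
  discrete solution, no a priori bound on that solution is needed.\<close>

section \<open>The discrete energy\<close>

text \<open>The discrete gradient does not see constants, so the squared error is put into the
  energy by hand. The scheme does not conserve it, and it comes back as a zeroth order source with
  coefficient 1/2 for each of the two outer time levels, next to the Lipschitz bound of the
  nonlinearity, half the maximum of \<open>F''\<close> for each level. Their sum is the origin of
  \<open>1 + maxabs (deriv (deriv F)) C1\<close> in the condition on \<open>B\<close>.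

  The obstacle at the walls is that a one-sided difference is only first order accurate. Its leading
  error is half a cell times the second space derivative, and exactly this term is cancelled by the
  half cell of the wave equation that the elimination of the ghost value brings in. What remains is
  of second order but, unlike an interior defect, carries no factor \<open>dx\<close>. The unit
  point mass absorbs it, and the total mass \<open>dx * real K + 2\<close> equals
  \<open>L + 2\<close> on every grid.\<close>

definition wt :: "real \<Rightarrow> nat \<Rightarrow> int \<Rightarrow> real" where
  "wt dx K k = (if k = 0 \<or> k = int K then dx / 2 else dx)"

text \<open>Eliminating the ghost value from the scheme and the dynamic boundary condition at an end
  point, and multiplying by \<open>dx / 2\<close>, leaves an equation in which the second time difference carries
  the mass \<open>1 + dx / 2\<close>: the wall contributes 1, the half cell \<open>dx / 2\<close>.  After this elimination the
  scheme reads \<open>resid = 0\<close>.\<close>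

definition mass :: "real \<Rightarrow> nat \<Rightarrow> int \<Rightarrow> real" where
  "mass dx K k = (if k = 0 \<or> k = int K then 1 + dx / 2 else dx)"

text \<open>The extension by zero says that nothing flows past the end points: interior and end
  equations share one divergence form, and summation by parts leaves no boundary terms. The dynamic
  condition at a wall then shows only in \<open>mass\<close>.\<close>

definition flux :: "real \<Rightarrow> nat \<Rightarrow> (int \<Rightarrow> real) \<Rightarrow> int \<Rightarrow> real" where
  "flux dx K V k = (if 0 \<le> k \<and> k < int K then dk_plus dx V k else 0)"

text \<open>For \<open>k\<close> in \<open>{0..int K}\<close> no ghost value enters, so the
  expression is meaningful for \<open>grid\<close> as well, whose ghost points lie outside the
  domain of \<open>u\<close>. This allows the exact and the discrete solution to be compared in the
  same equation.\<close>

definition resid ::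
    "real \<Rightarrow> real \<Rightarrow> nat \<Rightarrow> (real \<Rightarrow> real) \<Rightarrow> (nat \<Rightarrow> int \<Rightarrow> real) \<Rightarrow> nat \<Rightarrow> int \<Rightarrow> real" where
  "resid dt dx K F V n k =
     mass dx K k * dn_second dt V n k
     - (flux dx K (time_avg V n) k - flux dx K (time_avg V n) (k - 1))
     + wt dx K k * diff_quot F (V (n + 1) k) (V (n - 1) k)"

text \<open>The last two sums average squares over adjacent time levels to match
  \<open>time_avg\<close>: its product with a difference across two steps is a difference of such
  averages. For \<open>dx > 0\<close> the wall velocities have weight at least 1 and so stay
  controlled pointwise.\<close>

definition energy :: "real \<Rightarrow> real \<Rightarrow> nat \<Rightarrow> (nat \<Rightarrow> int \<Rightarrow> real) \<Rightarrow> nat \<Rightarrow> real" where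
  "energy dt dx K e n =
     (\<Sum>k = 0..int K. mass dx K k * (dn_minus dt e n k)\<^sup>2)
     + (\<Sum>k = 0..int K - 1. ((dk_plus dx (e n) k)\<^sup>2 + (dk_plus dx (e (n - 1)) k)\<^sup>2) * dx) / 2
     + (\<Sum>k = 0..int K. wt dx K k * ((e n k)\<^sup>2 + (e (n - 1) k)\<^sup>2)) / 2"

section \<open>Summation formulas and the energy identity\<close>

lemma sum_int_Suc:
  fixes f :: "int \<Rightarrow> real"
  shows "(\<Sum>k = 0..int (Suc n). f k) = (\<Sum>k = 0..int n. f k) + f (int (Suc n))"
proof -
  have "{0..int (Suc n)} = insert (int (Suc n)) {0..int n}" by auto
  then show ?thesis by simp
qed

lemma sum_ends:
  fixes f :: "int \<Rightarrow> real"
  assumes "K > 0"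
  shows "(\<Sum>k = 0..int K. f k) = f 0 + (\<Sum>k = 1..int K - 1. f k) + f (int K)"
proof -
  have "{0..int K} = insert 0 (insert (int K) {1..int K - 1})" using assms by auto
  then show ?thesis using assms by simp
qed

lemma trapez_eq_sum_wt:
  assumes "K > 0"
  shows "trapez dx K f = (\<Sum>k = 0..int K. wt dx K k * f k)"
  using assms by (simp add: sum_ends trapez_def wt_def mult.commute)

lemma sum_mass:
  assumes "K > 0"
  shows "(\<Sum>k = 0..int K. mass dx K k) = dx * real K + 2"
  using assms by (simp add: sum_ends mass_def of_nat_diff field_simps)

lemma summation_by_parts:
  fixes D g :: "int \<Rightarrow> real"
  shows "(\<Sum>k = 0..int K. (D k - D (k - 1)) * g k)
     = D (int K) * g (int K) - D (- 1) * g 0 - (\<Sum>k = 0..int K - 1. D k * (g (k + 1) - g k))"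
proof (induction K)
  case (Suc K)
  have "(\<Sum>k = 0..int (Suc K) - 1. D k * (g (k + 1) - g k))
      = (\<Sum>k = 0..int K - 1. D k * (g (k + 1) - g k)) + D (int K) * (g (int K + 1) - g (int K))"
  proof -
    have "{0..int (Suc K) - 1} = insert (int K) {0..int K - 1}" by auto
    then show ?thesis by simp
  qed
  then show ?case using Suc by (simp only: sum_int_Suc) (simp add: algebra_simps)
qed (simp add: algebra_simps)

text \<open>An identity for arbitrary families; no equation is used. The multiplier
  \<open>e (n + 1) k - e (n - 1) k\<close> is \<open>dt\<close> times the sum of two consecutive
  velocities. It makes the kinetic and the zeroth order terms telescope directly and the flux term
  after summation by parts.\<close>

lemma energy_increment:
  fixes e :: "nat \<Rightarrow> int \<Rightarrow> real"
  assumes "dt \<noteq> 0" "dx \<noteq> 0" "n \<ge> 1"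
  shows "energy dt dx K e (n + 1) - energy dt dx K e n =
     dt * (\<Sum>k = 0..int K. (dn_minus dt e (n + 1) k + dn_minus dt e n k) *
       (mass dx K k * dn_second dt e n k
        - (flux dx K (time_avg e n) k - flux dx K (time_avg e n) (k - 1))
        + wt dx K k * time_avg e n k))"
proof -
  define g where "g k = dn_minus dt e (n + 1) k + dn_minus dt e n k" for k
  have g: "dt * g k = e (n + 1) k - e (n - 1) k" for k
    using assms by (simp add: g_def dn_minus_def field_simps)
  have pq: "dt * (g k * dn_second dt e n k) = (dn_minus dt e (n + 1) k)\<^sup>2 - (dn_minus dt e n k)\<^sup>2" for k
  proof -
    have "dt * dn_second dt e n k = dn_minus dt e (n + 1) k - dn_minus dt e n k"
      using assms by (simp add: dn_minus_def dn_second_def power2_eq_square field_simps)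
    then have "dt * (g k * dn_second dt e n k) = g k * (dn_minus dt e (n + 1) k - dn_minus dt e n k)"
      by (metis mult.left_commute)
    then show ?thesis by (simp add: g_def power2_eq_square algebra_simps)
  qed
  have kin: "(\<Sum>k = 0..int K. mass dx K k * (dn_minus dt e (n + 1) k)\<^sup>2)
      - (\<Sum>k = 0..int K. mass dx K k * (dn_minus dt e n k)\<^sup>2)
      = dt * (\<Sum>k = 0..int K. g k * (mass dx K k * dn_second dt e n k))"
    unfolding sum_subtractf[symmetric] sum_distrib_left
  proof (rule sum.cong[OF refl])
    fix k
    have "dt * (g k * (mass dx K k * dn_second dt e n k))
        = mass dx K k * (dt * (g k * dn_second dt e n k))" by simp
    then show "mass dx K k * (dn_minus dt e (n + 1) k)\<^sup>2 - mass dx K k * (dn_minus dt e n k)\<^sup>2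
        = dt * (g k * (mass dx K k * dn_second dt e n k))"
      by (simp only: pq right_diff_distrib)
  qed
  have pot: "(\<Sum>k = 0..int K. wt dx K k * ((e (n + 1) k)\<^sup>2 + (e n k)\<^sup>2)) / 2
      - (\<Sum>k = 0..int K. wt dx K k * ((e n k)\<^sup>2 + (e (n - 1) k)\<^sup>2)) / 2
      = dt * (\<Sum>k = 0..int K. g k * (wt dx K k * time_avg e n k))"
    unfolding sum_subtractf[symmetric] sum_distrib_left sum_divide_distrib
  proof (rule sum.cong[OF refl])
    fix k
    have "dt * (g k * (wt dx K k * time_avg e n k))
        = (dt * g k) * (wt dx K k * time_avg e n k)" by simp
    then show "wt dx K k * ((e (n + 1) k)\<^sup>2 + (e n k)\<^sup>2) / 2
        - wt dx K k * ((e n k)\<^sup>2 + (e (n - 1) k)\<^sup>2) / 2 = dt * (g k * (wt dx K k * time_avg e n k))"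
      unfolding g by (simp add: time_avg_def power2_eq_square field_simps)
  qed
  define D where "D = flux dx K (time_avg e n)"
  have "dt * (\<Sum>k = 0..int K. g k * (D k - D (k - 1)))
      = - (dt * (\<Sum>k = 0..int K - 1. D k * (g (k + 1) - g k)))"
  proof -
    have "D (int K) = 0" "D (- 1) = 0" by (auto simp: D_def flux_def)
    then have "(\<Sum>k = 0..int K. (D k - D (k - 1)) * g k)
        = - (\<Sum>k = 0..int K - 1. D k * (g (k + 1) - g k))"
      using summation_by_parts[of D g K] by simp
    then show ?thesis by (simp add: mult.commute)
  qed
  moreover have "(\<Sum>k = 0..int K - 1. ((dk_plus dx (e (n + 1)) k)\<^sup>2 + (dk_plus dx (e n) k)\<^sup>2) * dx) / 2
      - (\<Sum>k = 0..int K - 1. ((dk_plus dx (e n) k)\<^sup>2 + (dk_plus dx (e (n - 1)) k)\<^sup>2) * dx) / 2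
      = dt * (\<Sum>k = 0..int K - 1. D k * (g (k + 1) - g k))"
    unfolding sum_subtractf[symmetric] sum_distrib_left sum_divide_distrib
  proof (rule sum.cong[OF refl])
    fix k assume k: "k \<in> {0..int K - 1}"
    have Dk: "D k = (dk_plus dx (e (n + 1)) k + dk_plus dx (e (n - 1)) k) / 2"
      using k assms by (simp add: D_def flux_def dk_plus_def time_avg_def field_simps)
    have "dt * (D k * (g (k + 1) - g k)) = D k * (dt * g (k + 1) - dt * g k)"
      by (simp add: algebra_simps)
    also have "\<dots> = D k * ((dk_plus dx (e (n + 1)) k - dk_plus dx (e (n - 1)) k) * dx)"
      unfolding g using assms by (simp add: dk_plus_def field_simps)
    finally have *: "dt * (D k * (g (k + 1) - g k))
        = (dk_plus dx (e (n + 1)) k + dk_plus dx (e (n - 1)) k) / 2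
          * ((dk_plus dx (e (n + 1)) k - dk_plus dx (e (n - 1)) k) * dx)"
      by (simp only: Dk)
    show "((dk_plus dx (e (n + 1)) k)\<^sup>2 + (dk_plus dx (e n) k)\<^sup>2) * dx / 2
        - ((dk_plus dx (e n) k)\<^sup>2 + (dk_plus dx (e (n - 1)) k)\<^sup>2) * dx / 2
        = dt * (D k * (g (k + 1) - g k))"
      unfolding * by (simp add: power2_eq_square field_simps)
  qed
  ultimately have grad: "(\<Sum>k = 0..int K - 1. ((dk_plus dx (e (n + 1)) k)\<^sup>2 + (dk_plus dx (e n) k)\<^sup>2) * dx) / 2
      - (\<Sum>k = 0..int K - 1. ((dk_plus dx (e n) k)\<^sup>2 + (dk_plus dx (e (n - 1)) k)\<^sup>2) * dx) / 2
      = - (dt * (\<Sum>k = 0..int K. g k * (D k - D (k - 1))))" by simp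
  have "energy dt dx K e (n + 1) - energy dt dx K e n =
      dt * (\<Sum>k = 0..int K. g k * (mass dx K k * dn_second dt e n k))
      - dt * (\<Sum>k = 0..int K. g k * (D k - D (k - 1)))
      + dt * (\<Sum>k = 0..int K. g k * (wt dx K k * time_avg e n k))"
    unfolding energy_def using kin pot grad by simp
  also have "\<dots> = dt * (\<Sum>k = 0..int K. g k *
       (mass dx K k * dn_second dt e n k - (D k - D (k - 1)) + wt dx K k * time_avg e n k))"
    by (simp add: distrib_left right_diff_distrib sum.distrib sum_subtractf)
  finally show ?thesis by (simp add: g_def D_def)
qed

text \<open>At a wall the boundary condition is added to \<open>dx / 2\<close> times the equation:
  \<open>dk_first\<close> plus \<open>dx / 2\<close> times \<open>dk_second\<close> is the forward
  difference, so the ghost value drops out. At the right wall the sign of \<open>dk_first\<close>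
  changes and minus the backward difference remains.\<close>

lemma solves_scheme_resid:
  assumes "solves_scheme dt dx N K F U" "dx > 0" "K > 0" "n \<in> {1..<N}" "k \<in> {0..int K}"
  shows "resid dt dx K F U n k = 0"
proof -
  define w where "w = time_avg U n"
  define q where "q = diff_quot F (U (n + 1) k) (U (n - 1) k)"
  have r: "resid dt dx K F U n k = mass dx K k * dn_second dt U n k
      - (flux dx K w k - flux dx K w (k - 1)) + wt dx K k * q"
    by (simp add: resid_def w_def q_def)
  have eq: "dn_second dt U n k = dk_second dx w k - q"
    and eq0: "dn_second dt U n 0 - dk_first dx w 0 = 0"
    and eqK: "dn_second dt U n (int K) + dk_first dx w (int K) = 0"
    using assms unfolding solves_scheme_def w_def q_def by blast+
  consider "k = 0" | "k = int K" "k \<noteq> 0" | "k \<noteq> 0" "k \<noteq> int K" by blast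
  then show ?thesis
  proof cases
    case 1
    have "resid dt dx K F U n k = dn_second dt U n 0 + dx / 2 * (dn_second dt U n k + q)
        - dk_plus dx w 0"
      unfolding r using assms 1 by (simp add: mass_def wt_def flux_def algebra_simps)
    also have "\<dots> = dk_first dx w 0 + dx / 2 * dk_second dx w 0 - dk_plus dx w 0"
      using eq eq0 1 by simp
    also have "\<dots> = 0"
      using assms by (simp add: dk_first_def dk_second_def dk_plus_def power2_eq_square field_simps)
    finally show ?thesis .
  next
    case 2
    have "resid dt dx K F U n k = dn_second dt U n (int K) + dx / 2 * (dn_second dt U n k + q)
        + dk_plus dx w (int K - 1)"
      unfolding r using assms 2 by (simp add: mass_def wt_def flux_def algebra_simps)
    also have "\<dots> = - dk_first dx w (int K) + dx / 2 * dk_second dx w (int K) + dk_plus dx w (int K - 1)"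
      using eq eqK 2 by simp
    also have "\<dots> = 0"
      using assms by (simp add: dk_first_def dk_second_def dk_plus_def power2_eq_square field_simps)
    finally show ?thesis .
  next
    case 3
    have "resid dt dx K F U n k = dx * (dn_second dt U n k + q) - (dk_plus dx w k - dk_plus dx w (k - 1))"
      unfolding r using assms 3 by (simp add: mass_def wt_def flux_def algebra_simps)
    also have "\<dots> = dx * dk_second dx w k - (dk_plus dx w k - dk_plus dx w (k - 1))"
      using eq by simp
    also have "\<dots> = 0"
      using assms by (simp add: dk_second_def dk_plus_def power2_eq_square field_simps)
    finally show ?thesis .
  qed
qed

lemma resid_diff:
  fixes U V :: "nat \<Rightarrow> int \<Rightarrow> real"
  defines "e \<equiv> \<lambda>n k. U n k - V n k"
  shows "mass dx K k * dn_second dt e n k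
       - (flux dx K (time_avg e n) k - flux dx K (time_avg e n) (k - 1))
     = resid dt dx K F U n k - resid dt dx K F V n k
       - wt dx K k * (diff_quot F (U (n + 1) k) (U (n - 1) k) - diff_quot F (V (n + 1) k) (V (n - 1) k))"
proof -
  have dn: "dn_second dt e n k = dn_second dt U n k - dn_second dt V n k"
    by (simp add: e_def dn_second_def diff_divide_distrib[symmetric] algebra_simps)
  have avg: "time_avg e n i = time_avg U n i - time_avg V n i" for i
    by (simp add: e_def time_avg_def field_simps)
  have fl: "flux dx K (time_avg e n) j = flux dx K (time_avg U n) j - flux dx K (time_avg V n) j" for j
    unfolding flux_def dk_plus_def avg by (simp add: diff_divide_distrib[symmetric])
  show ?thesis unfolding resid_def dn fl by (simp add: algebra_simps)
qed

section \<open>The energy inequality for one time step\<close>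

lemma wt_le_mass: "dx \<ge> 0 \<Longrightarrow> 0 \<le> wt dx K k \<and> wt dx K k \<le> mass dx K k"
  by (simp add: wt_def mass_def)

text \<open>The Young weights keep the coefficient at \<open>7 * A / 8\<close>, strictly below \<open>A\<close>. With \<open>A = 1 / B\<close> the
  implicit part of the energy can then be absorbed uniformly for all time steps below \<open>B\<close>.\<close>

lemma weighted_Young:
  fixes p q x y g r w m A s :: real
  assumes "A > 0" "0 \<le> w" "w \<le> m" "\<bar>r\<bar> \<le> m * s" "\<bar>g\<bar> \<le> A / 2 * (\<bar>x\<bar> + \<bar>y\<bar>)"
  shows "(p + q) * (w * g - r)
     \<le> 7 * A / 8 * (m * (p\<^sup>2 + q\<^sup>2) + w * (x\<^sup>2 + y\<^sup>2) / 2) + m * (4 * s\<^sup>2 / A)"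
proof -
  have sq: "(\<bar>a\<bar> + \<bar>b\<bar>)\<^sup>2 \<le> 2 * (a\<^sup>2 + b\<^sup>2)" for a b :: real
    using sum_squares_bound[of "\<bar>a\<bar>" "\<bar>b\<bar>"] by (simp add: power2_sum)
  have m: "m \<ge> 0" using assms by simp
  \<comment> \<open>The energy weighs velocities by 1 but squared errors by 1/2, so the two sides
    get unequal weights. After the factor \<open>A / 2\<close> the velocities cost
    \<open>3 * A / 4\<close> and the squared errors \<open>A / 3\<close>, within their budget
    \<open>7 * A / 16\<close>; this leaves \<open>A / 8\<close> of velocity for the truncation
    error.\<close>
  have "a * b \<le> 3 / 4 * a\<^sup>2 + 1 / 3 * b\<^sup>2" for a b :: real
    using zero_le_power2[of "3 * a - 2 * b"] by (simp add: power2_diff power_mult_distrib)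
  then have "(\<bar>p\<bar> + \<bar>q\<bar>) * (\<bar>x\<bar> + \<bar>y\<bar>) \<le> 3 / 4 * (\<bar>p\<bar> + \<bar>q\<bar>)\<^sup>2 + 1 / 3 * (\<bar>x\<bar> + \<bar>y\<bar>)\<^sup>2" .
  also have "\<dots> \<le> 3 / 4 * (2 * (p\<^sup>2 + q\<^sup>2)) + 1 / 3 * (2 * (x\<^sup>2 + y\<^sup>2))"
    by (intro add_mono mult_left_mono sq) auto
  also have "\<dots> = 3 / 2 * (p\<^sup>2 + q\<^sup>2) + 2 / 3 * (x\<^sup>2 + y\<^sup>2)" by simp
  finally have Y1: "(\<bar>p\<bar> + \<bar>q\<bar>) * (\<bar>x\<bar> + \<bar>y\<bar>) \<le> 3 / 2 * (p\<^sup>2 + q\<^sup>2) + 2 / 3 * (x\<^sup>2 + y\<^sup>2)" .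
  have "\<bar>p + q\<bar> * \<bar>g\<bar> \<le> (\<bar>p\<bar> + \<bar>q\<bar>) * (A / 2 * (\<bar>x\<bar> + \<bar>y\<bar>))"
    using assms by (intro mult_mono) auto
  also have "\<dots> = A / 2 * ((\<bar>p\<bar> + \<bar>q\<bar>) * (\<bar>x\<bar> + \<bar>y\<bar>))" by simp
  also have "\<dots> \<le> A / 2 * (3 / 2 * (p\<^sup>2 + q\<^sup>2) + 2 / 3 * (x\<^sup>2 + y\<^sup>2))"
    using Y1 assms by (intro mult_left_mono) auto
  finally have "\<bar>p + q\<bar> * \<bar>g\<bar> \<le> A / 2 * (3 / 2 * (p\<^sup>2 + q\<^sup>2) + 2 / 3 * (x\<^sup>2 + y\<^sup>2))" .
  then have "w * (\<bar>p + q\<bar> * \<bar>g\<bar>) \<le> w * (A / 2 * (3 / 2 * (p\<^sup>2 + q\<^sup>2) + 2 / 3 * (x\<^sup>2 + y\<^sup>2)))"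
    using assms by (intro mult_left_mono) auto
  also have "\<dots> = w * (3 * A / 4 * (p\<^sup>2 + q\<^sup>2)) + A / 3 * (w * (x\<^sup>2 + y\<^sup>2))"
    by (simp add: algebra_simps)
  also have "\<dots> \<le> m * (3 * A / 4 * (p\<^sup>2 + q\<^sup>2)) + 7 * A / 16 * (w * (x\<^sup>2 + y\<^sup>2))"
    using assms by (intro add_mono mult_right_mono) auto
  finally have I1: "w * (\<bar>p + q\<bar> * \<bar>g\<bar>)
      \<le> m * (3 * A / 4 * (p\<^sup>2 + q\<^sup>2)) + 7 * A / 16 * (w * (x\<^sup>2 + y\<^sup>2))" .
  \<comment> \<open>The weight 8 is chosen so that \<open>\<bar>p + q\<bar> * s\<close> uses exactly
    the remaining \<open>A / 8\<close> of the velocity budget.\<close>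
  have "0 \<le> (A * \<bar>p + q\<bar> - 8 * s)\<^sup>2" by simp
  then have "16 * A * (\<bar>p + q\<bar> * s) \<le> A\<^sup>2 * (p + q)\<^sup>2 + 64 * s\<^sup>2"
    by (simp add: power2_diff power_mult_distrib algebra_simps)
  also have "\<dots> \<le> A\<^sup>2 * (2 * (p\<^sup>2 + q\<^sup>2)) + 64 * s\<^sup>2"
    using sum_squares_bound[of p q]
    by (intro add_right_mono mult_left_mono) (simp_all add: power2_sum)
  finally have "\<bar>p + q\<bar> * s \<le> A / 8 * (p\<^sup>2 + q\<^sup>2) + 4 * s\<^sup>2 / A"
    using assms by (simp add: field_simps power2_eq_square)
  then have I2: "m * (\<bar>p + q\<bar> * s) \<le> m * (A / 8 * (p\<^sup>2 + q\<^sup>2) + 4 * s\<^sup>2 / A)"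
    using m by (intro mult_left_mono) auto
  have "(p + q) * (w * g - r) \<le> \<bar>p + q\<bar> * (w * \<bar>g\<bar> + \<bar>r\<bar>)"
  proof -
    have "\<bar>w * g - r\<bar> \<le> w * \<bar>g\<bar> + \<bar>r\<bar>"
      using assms abs_triangle_ineq4[of "w * g" r] by (simp add: abs_mult)
    then have "\<bar>p + q\<bar> * \<bar>w * g - r\<bar> \<le> \<bar>p + q\<bar> * (w * \<bar>g\<bar> + \<bar>r\<bar>)" by (intro mult_left_mono) auto
    then show ?thesis by (metis abs_ge_self abs_mult order_trans)
  qed
  also have "\<dots> \<le> \<bar>p + q\<bar> * (w * \<bar>g\<bar> + m * s)"
    using assms by (intro mult_left_mono) auto
  also have "\<dots> = w * (\<bar>p + q\<bar> * \<bar>g\<bar>) + m * (\<bar>p + q\<bar> * s)"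
    by (simp add: algebra_simps)
  also have "\<dots> \<le> m * (3 * A / 4 * (p\<^sup>2 + q\<^sup>2)) + 7 * A / 16 * (w * (x\<^sup>2 + y\<^sup>2))
      + m * (A / 8 * (p\<^sup>2 + q\<^sup>2) + 4 * s\<^sup>2 / A)"
    using I1 I2 by (rule add_mono)
  also have "\<dots> = 7 * A / 8 * (m * (p\<^sup>2 + q\<^sup>2) + w * (x\<^sup>2 + y\<^sup>2) / 2) + m * (4 * s\<^sup>2 / A)"
    by (simp add: algebra_simps)
  finally show ?thesis .
qed

text \<open>The Lipschitz hypothesis has \<open>A - 1\<close> because the squared error in the
  energy contributes \<open>time_avg e\<close>, which costs another 1/2 per argument; together they
  give the \<open>A / 2\<close> required by \<open>weighted_Young\<close>. The truncation error is
  measured relative to \<open>mass\<close>, so its squares sum to a multiple of the total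
  mass.\<close>

lemma energy_step:
  fixes U V :: "nat \<Rightarrow> int \<Rightarrow> real"
  defines "e \<equiv> \<lambda>n k. U n k - V n k"
  assumes "A > 0" "dt > 0" "dx > 0" "K > 0" "n \<ge> 1"
    and U: "\<And>k. k \<in> {0..int K} \<Longrightarrow> resid dt dx K F U n k = 0"
    and V: "\<And>k. k \<in> {0..int K} \<Longrightarrow> \<bar>resid dt dx K F V n k\<bar> \<le> mass dx K k * s"
    and q: "\<And>k. k \<in> {0..int K} \<Longrightarrow>
        \<bar>diff_quot F (U (n + 1) k) (U (n - 1) k) - diff_quot F (V (n + 1) k) (V (n - 1) k)\<bar>
        \<le> (A - 1) / 2 * (\<bar>e (n + 1) k\<bar> + \<bar>e (n - 1) k\<bar>)"
  shows "energy dt dx K e (n + 1) - energy dt dx K e n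
     \<le> dt * (7 * A / 8 * (energy dt dx K e (n + 1) + energy dt dx K e n)
             + (dx * real K + 2) * (4 * s\<^sup>2 / A))"
proof -
  let ?p = "\<lambda>k. dn_minus dt e (n + 1) k" and ?q = "\<lambda>k. dn_minus dt e n k"
  let ?G = "\<lambda>k. diff_quot F (U (n + 1) k) (U (n - 1) k) - diff_quot F (V (n + 1) k) (V (n - 1) k)"
  have "energy dt dx K e (n + 1) - energy dt dx K e n =
     dt * (\<Sum>k = 0..int K. (?p k + ?q k) *
       (mass dx K k * dn_second dt e n k
        - (flux dx K (time_avg e n) k - flux dx K (time_avg e n) (k - 1))
        + wt dx K k * time_avg e n k))"
    using assms by (intro energy_increment) auto
  also have "\<dots> \<le> dt * (\<Sum>k = 0..int K. 7 * A / 8 * (mass dx K k * ((?p k)\<^sup>2 + (?q k)\<^sup>2)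
        + wt dx K k * ((e (n + 1) k)\<^sup>2 + (e (n - 1) k)\<^sup>2) / 2) + mass dx K k * (4 * s\<^sup>2 / A))"
  proof (intro mult_left_mono sum_mono)
    fix k assume k: "k \<in> {0..int K}"
    have "mass dx K k * dn_second dt e n k
        - (flux dx K (time_avg e n) k - flux dx K (time_avg e n) (k - 1))
        = 0 - resid dt dx K F V n k - wt dx K k * ?G k"
      unfolding e_def U[OF k, symmetric] by (rule resid_diff)
    then have eq: "mass dx K k * dn_second dt e n k
        - (flux dx K (time_avg e n) k - flux dx K (time_avg e n) (k - 1)) + wt dx K k * time_avg e n k
        = wt dx K k * (time_avg e n k - ?G k) - resid dt dx K F V n k"
      by (simp add: algebra_simps)
    have g: "\<bar>time_avg e n k - ?G k\<bar> \<le> A / 2 * (\<bar>e (n + 1) k\<bar> + \<bar>e (n - 1) k\<bar>)"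
    proof -
      have "\<bar>time_avg e n k - ?G k\<bar> \<le> (\<bar>e (n + 1) k\<bar> + \<bar>e (n - 1) k\<bar>) / 2
          + (A - 1) / 2 * (\<bar>e (n + 1) k\<bar> + \<bar>e (n - 1) k\<bar>)"
      proof -
        have "\<bar>(x + y) / 2 - g\<bar> \<le> (\<bar>x\<bar> + \<bar>y\<bar>) / 2 + r" if "\<bar>g\<bar> \<le> r" for x y g r :: real
          using that by argo
        then show ?thesis unfolding time_avg_def using q[OF k] by blast
      qed
      then show ?thesis by (simp add: field_simps)
    qed
    show "(?p k + ?q k) *
       (mass dx K k * dn_second dt e n k
        - (flux dx K (time_avg e n) k - flux dx K (time_avg e n) (k - 1))
        + wt dx K k * time_avg e n k)
      \<le> 7 * A / 8 * (mass dx K k * ((?p k)\<^sup>2 + (?q k)\<^sup>2)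
        + wt dx K k * ((e (n + 1) k)\<^sup>2 + (e (n - 1) k)\<^sup>2) / 2) + mass dx K k * (4 * s\<^sup>2 / A)"
      unfolding eq using wt_le_mass[of dx K k] \<open>dx > 0\<close>
      by (intro weighted_Young[OF \<open>A > 0\<close> _ _ V[OF k] g]) auto
  qed (use assms in simp)
  also have "\<dots> = dt * (7 * A / 8 * (\<Sum>k = 0..int K. mass dx K k * ((?p k)\<^sup>2 + (?q k)\<^sup>2)
        + wt dx K k * ((e (n + 1) k)\<^sup>2 + (e (n - 1) k)\<^sup>2) / 2)
      + (\<Sum>k = 0..int K. mass dx K k) * (4 * s\<^sup>2 / A))"
    by (simp only: sum.distrib sum_distrib_left[symmetric] sum_distrib_right[symmetric])
  also have "\<dots> \<le> dt * (7 * A / 8 * (energy dt dx K e (n + 1) + energy dt dx K e n)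
             + (dx * real K + 2) * (4 * s\<^sup>2 / A))"
  proof -
    \<comment> \<open>The increment involves the levels \<open>n + 1\<close> and
      \<open>n - 1\<close>. One occurs in each of the two energies, and the squares at level
      \<open>n\<close> are surplus.\<close>
    have "(\<Sum>k = 0..int K. wt dx K k * ((e (n + 1) k)\<^sup>2 + (e (n - 1) k)\<^sup>2) / 2)
        \<le> (\<Sum>k = 0..int K. wt dx K k * ((e (n + 1) k)\<^sup>2 + (e n k)\<^sup>2)) / 2
          + (\<Sum>k = 0..int K. wt dx K k * ((e n k)\<^sup>2 + (e (n - 1) k)\<^sup>2)) / 2"
      unfolding sum_divide_distrib sum.distrib[symmetric]
      using assms by (intro sum_mono) (simp add: wt_le_mass field_simps)
    moreover have "0 \<le> (\<Sum>k = 0..int K - 1. ((dk_plus dx (e n) k)\<^sup>2 + (dk_plus dx (e (n - 1)) k)\<^sup>2) * dx)"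
      "0 \<le> (\<Sum>k = 0..int K - 1. ((dk_plus dx (e (n + 1)) k)\<^sup>2 + (dk_plus dx (e n) k)\<^sup>2) * dx)"
      using assms by (auto intro!: sum_nonneg)
    ultimately have "(\<Sum>k = 0..int K. mass dx K k * ((?p k)\<^sup>2 + (?q k)\<^sup>2)
        + wt dx K k * ((e (n + 1) k)\<^sup>2 + (e (n - 1) k)\<^sup>2) / 2)
        \<le> energy dt dx K e (n + 1) + energy dt dx K e n"
      unfolding energy_def sum.distrib distrib_left[of "mass _ _ _"] by simp
    then show ?thesis
      unfolding sum_mass[OF \<open>K > 0\<close>] using assms
      by (intro mult_left_mono add_right_mono) auto
  qed
  finally show ?thesis .
qed

section \<open>Discrete Gronwall inequality and recovery of the norms\<close>

lemma discrete_Gronwall: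
  fixes E :: "nat \<Rightarrow> real"
  assumes "0 \<le> z" "z \<le> 7 / 8" "0 \<le> b"
    and "E 1 = 0" and "\<And>n. n \<in> {1..<N} \<Longrightarrow> E (n + 1) - E n \<le> z * (E (n + 1) + E n) + b"
    and nonneg: "\<And>n. E n \<ge> 0"
    and "n \<in> {1..N}"
  shows "E n \<le> 8 * b * n * exp (16 * z * n)"
proof -
  have "n \<le> N \<Longrightarrow> E n \<le> 8 * b * n * (1 + 16 * z) ^ n" if "n \<ge> 1" for n
    using that
  proof (induction n rule: dec_induct)
    case base
    then show ?case using assms by simp
  next
    case (step n)
    let ?x = "(1 + 16 * z) ^ n"
    have x: "?x \<ge> 1" using assms by (intro one_le_power) auto
    have "(1 - z) * E (n + 1) \<le> (1 + z) * E n + b"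
      using assms(5)[of n] step by (simp add: algebra_simps)
    \<comment> \<open>Since \<open>1 / (1 - z)\<close> is at most 8, dividing by
      \<open>1 - z\<close> turns \<open>1 + z\<close> into at most \<open>1 + 16 * z\<close> and
      \<open>b\<close> into at most \<open>8 * b\<close>. The excess over 1 stays proportional to
      \<open>z\<close>, hence to the time step, which keeps the product over all steps
      bounded.\<close>
    also have "\<dots> \<le> (1 - z) * ((1 + 16 * z) * E n + 8 * b)"
    proof -
      have "z * (1 - z) \<ge> z * (1 / 8)" using assms by (intro mult_left_mono) auto
      then have "E n * (16 * (z * (1 - z)) - 2 * z) \<ge> 0" using nonneg[of n] by simp
      moreover have "b * (7 - 8 * z) \<ge> 0" using assms by simp
      ultimately show ?thesis by (simp add: algebra_simps)
    qed
    finally have "E (n + 1) \<le> (1 + 16 * z) * E n + 8 * b" using assms by simp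
    also have "\<dots> \<le> (1 + 16 * z) * (8 * b * n * ?x) + 8 * b * ((1 + 16 * z) * ?x)"
    proof (rule add_mono)
      have "1 \<le> (1 + 16 * z) * ?x" using x assms mult_mono[of 1 "1 + 16 * z" 1 ?x] by simp
      then show "8 * b \<le> 8 * b * ((1 + 16 * z) * ?x)" using assms mult_left_mono[of 1 _ "8 * b"] by simp
    qed (use step assms in \<open>intro mult_left_mono, auto\<close>)
    also have "\<dots> = 8 * b * (Suc n) * (1 + 16 * z) ^ Suc n" by (simp add: algebra_simps)
    finally show ?case by simp
  qed
  then have "E n \<le> 8 * b * n * (1 + 16 * z) ^ n" using assms by simp
  also have "(1 + 16 * z) ^ n \<le> exp (16 * z) ^ n" using assms by (intro power_mono) auto
  also have "exp (16 * z) ^ n = exp (16 * z * n)" by (simp add: exp_of_nat_mult mult.commute)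
  finally show ?thesis using assms by (simp add: mult_left_mono)
qed

lemma energy_nonneg:
  assumes "dx \<ge> 0"
  shows "energy dt dx K e n \<ge> 0"
  unfolding energy_def mass_def wt_def using assms by (auto intro!: add_nonneg_nonneg sum_nonneg)

text \<open>The 5 is 1 + 2 + 1 + 1. The H1 part costs 2 because its squares at level
  \<open>n\<close> carry only the factor 1/2 in the energy; the generous bound \<open>4 * E\<close>
  keeps the root simple. The wall velocities are covered since \<open>mass\<close> is at least 1
  there.\<close>

lemma error_norm_le_energy:
  assumes "dx > 0" "K > 0"
  shows "norm_2 dx K (dn_minus dt e n) + norm_H1 dx K (e n)
         + \<bar>dn_minus dt e n 0\<bar> + \<bar>dn_minus dt e n (int K)\<bar> \<le> 5 * sqrt (energy dt dx K e n)"
proof -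
  define E where "E = energy dt dx K e n"
  let ?q = "dn_minus dt e n"
  let ?kin = "\<Sum>k = 0..int K. mass dx K k * (?q k)\<^sup>2"
  let ?pot = "\<Sum>k = 0..int K. wt dx K k * (e n k)\<^sup>2"
  let ?grad = "\<Sum>k = 0..int K - 1. (dk_plus dx (e n) k)\<^sup>2 * dx"
  have kin0: "0 \<le> ?kin" and pot0: "0 \<le> ?pot" and grad0: "0 \<le> ?grad"
    and pot1: "0 \<le> (\<Sum>k = 0..int K. wt dx K k * (e (n - 1) k)\<^sup>2)"
    and grad1: "0 \<le> (\<Sum>k = 0..int K - 1. (dk_plus dx (e (n - 1)) k)\<^sup>2 * dx)"
    using assms by (auto intro!: sum_nonneg simp: wt_def mass_def)
  have E: "E = ?kin + (?grad + (\<Sum>k = 0..int K - 1. (dk_plus dx (e (n - 1)) k)\<^sup>2 * dx)) / 2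
      + (?pot + (\<Sum>k = 0..int K. wt dx K k * (e (n - 1) k)\<^sup>2)) / 2"
    unfolding E_def energy_def by (simp add: sum.distrib distrib_left distrib_right)
  have kin: "?kin \<le> E" and H1: "?pot + ?grad \<le> 4 * E"
  proof -
    have "k \<le> k + (g + g') / 2 + (p + p') / 2 \<and> p + g \<le> 4 * (k + (g + g') / 2 + (p + p') / 2)"
      if "0 \<le> k" "0 \<le> g" "0 \<le> g'" "0 \<le> p" "0 \<le> p'" for k g g' p p' :: real
      using that by (auto simp: field_simps)
    from this[OF kin0 grad0 grad1 pot0 pot1] show "?kin \<le> E" "?pot + ?grad \<le> 4 * E"
      unfolding E by blast+
  qed
  have "norm_2 dx K ?q \<le> sqrt E"
  proof -
    have "trapez dx K (\<lambda>k. \<bar>?q k\<bar>\<^sup>2) \<le> ?kin"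
      unfolding trapez_eq_sum_wt[OF \<open>K > 0\<close>] power2_abs using assms
      by (intro sum_mono mult_right_mono) (auto simp: wt_le_mass)
    then show ?thesis unfolding norm_2_def using kin by simp
  qed
  moreover have "norm_H1 dx K (e n) \<le> 2 * sqrt E"
  proof -
    have "norm_H1 dx K (e n) \<le> sqrt (4 * E)"
      unfolding norm_H1_def trapez_eq_sum_wt[OF \<open>K > 0\<close>] power2_abs using H1 by simp
    then show ?thesis by (simp add: real_sqrt_mult)
  qed
  moreover have "\<bar>?q k\<bar> \<le> sqrt E" if "k = 0 \<or> k = int K" for k
  proof -
    have "(?q k)\<^sup>2 \<le> mass dx K k * (?q k)\<^sup>2"
      using that assms by (simp add: mass_def distrib_right) 
    also have "\<dots> \<le> ?kin"
      using that assms by (intro member_le_sum[of k "{0..int K}"]) (auto simp: mass_def)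
    finally have "(?q k)\<^sup>2 \<le> E" using kin by simp
    then have "sqrt ((?q k)\<^sup>2) \<le> sqrt E" by (rule real_sqrt_le_mono)
    then show ?thesis by simp
  qed
  ultimately show ?thesis
    using E_def by (smt (verit))
qed

section \<open>Taylor expansions and difference quotients\<close>

text \<open>Here \<open>f i\<close> plays the part of the i-th derivative. Derivatives are taken
  within \<open>S\<close>, so the expansion may be centred at an end point of an interval, as the
  walls demand.\<close>

lemma real_Taylor:
  fixes f :: "nat \<Rightarrow> real \<Rightarrow> real"
  assumes S: "convex S"
    and f: "\<And>i x. x \<in> S \<Longrightarrow> i \<le> n \<Longrightarrow> (f i has_real_derivative f (Suc i) x) (at x within S)"
    and M: "\<And>x. x \<in> S \<Longrightarrow> \<bar>f (Suc n) x\<bar> \<le> M"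
    and x: "x \<in> S" "x + h \<in> S"
  shows "\<bar>f 0 (x + h) - (\<Sum>i\<le>n. f i x * h ^ i / fact i)\<bar> \<le> M * \<bar>h\<bar> ^ Suc n / fact n"
  using field_Taylor[of S n f M x "x + h"] assms by simp

lemma second_difference_bound:
  fixes f :: "nat \<Rightarrow> real \<Rightarrow> real"
  assumes "convex S"
    and "\<And>i x. x \<in> S \<Longrightarrow> i \<le> 3 \<Longrightarrow> (f i has_real_derivative f (Suc i) x) (at x within S)"
    and "\<And>x. x \<in> S \<Longrightarrow> \<bar>f 4 x\<bar> \<le> M"
    and "x - h \<in> S" "x \<in> S" "x + h \<in> S" "h > 0"
  shows "\<bar>(f 0 (x + h) - 2 * f 0 x + f 0 (x - h)) / h\<^sup>2 - f 2 x\<bar> \<le> M * h\<^sup>2"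
proof -
  define r where "r y = f 0 (x + y) - (\<Sum>i\<le>3. f i x * y ^ i / fact i)" for y
  have r: "\<bar>r y\<bar> \<le> M * \<bar>y\<bar> ^ 4 / 6" if "x + y \<in> S" for y
    using real_Taylor[of S 3 f M x y] assms that by (simp add: r_def fact_numeral)
  have M: "M \<ge> 0" using assms(3)[of x] assms by fastforce
  have "f 0 (x + h) - 2 * f 0 x + f 0 (x - h) - h\<^sup>2 * f 2 x = r h + r (- h)"
    by (simp add: r_def eval_nat_numeral field_simps)
  then have "(f 0 (x + h) - 2 * f 0 x + f 0 (x - h)) / h\<^sup>2 - f 2 x = (r h + r (- h)) / h\<^sup>2"
    using assms by (simp add: field_simps)
  also have "\<bar>\<dots>\<bar> \<le> (M * h ^ 4) / h\<^sup>2"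
  proof -
    have "\<bar>r h + r (- h)\<bar> \<le> M * h ^ 4 / 6 + M * h ^ 4 / 6"
      using r[of h] r[of "- h"] assms abs_triangle_ineq[of "r h" "r (- h)"] by simp
    also have "\<dots> \<le> M * h ^ 4" using M assms by simp
    finally show ?thesis by (simp add: divide_right_mono)
  qed
  also have "\<dots> = M * h\<^sup>2" using assms by (simp add: eval_nat_numeral)
  finally show ?thesis .
qed

lemma symmetric_average_bound:
  fixes f :: "nat \<Rightarrow> real \<Rightarrow> real"
  assumes "convex S"
    and "\<And>i x. x \<in> S \<Longrightarrow> i \<le> 1 \<Longrightarrow> (f i has_real_derivative f (Suc i) x) (at x within S)"
    and "\<And>x. x \<in> S \<Longrightarrow> \<bar>f 2 x\<bar> \<le> M"
    and "x - h \<in> S" "x \<in> S" "x + h \<in> S"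
  shows "\<bar>(f 0 (x + h) + f 0 (x - h)) / 2 - f 0 x\<bar> \<le> M * h\<^sup>2"
proof -
  define r where "r y = f 0 (x + y) - (\<Sum>i\<le>1. f i x * y ^ i / fact i)" for y
  have r: "\<bar>r y\<bar> \<le> M * y\<^sup>2" if "x + y \<in> S" for y
    using real_Taylor[of S 1 f M x y] assms that by (simp add: r_def eval_nat_numeral)
  have *: "(f 0 (x + h) + f 0 (x - h)) / 2 - f 0 x = (r h + r (- h)) / 2"
    by (simp add: r_def field_simps)
  have "\<bar>r h + r (- h)\<bar> \<le> M * h\<^sup>2 + M * h\<^sup>2"
    using r[of h] r[of "- h"] assms abs_triangle_ineq[of "r h" "r (- h)"] by simp
  then show ?thesis unfolding * by simp
qed

text \<open>The term \<open>h / 2 * f 2 x\<close> is kept apart from the error because at a wall it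
  cancels against the half cell of the wave equation. The sign \<open>s\<close> treats both walls at
  once.\<close>

lemma difference_quotient_bound:
  fixes f :: "nat \<Rightarrow> real \<Rightarrow> real"
  assumes "convex S"
    and "\<And>i x. x \<in> S \<Longrightarrow> i \<le> 2 \<Longrightarrow> (f i has_real_derivative f (Suc i) x) (at x within S)"
    and "\<And>x. x \<in> S \<Longrightarrow> \<bar>f 3 x\<bar> \<le> M"
    and "x \<in> S" "x + s * h \<in> S" "h > 0" "\<bar>s\<bar> = 1"
  shows "\<bar>(f 0 (x + s * h) - f 0 x) / h - (s * f 1 x + h / 2 * f 2 x)\<bar> \<le> M * h\<^sup>2"
proof -
  define r where "r = f 0 (x + s * h) - (\<Sum>i\<le>2. f i x * (s * h) ^ i / fact i)"
  have s: "s\<^sup>2 = 1" using assms by (simp add: abs_square_eq_1)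
  have M: "M \<ge> 0" using assms(3)[of x] assms by fastforce
  have "\<bar>r\<bar> \<le> M * \<bar>s * h\<bar> ^ 3 / 2"
    using real_Taylor[of S 2 f M x "s * h"] assms by (simp add: r_def eval_nat_numeral)
  then have "\<bar>r\<bar> \<le> M * h ^ 3 / 2" using assms by (simp add: abs_mult)
  also have "\<dots> \<le> M * h ^ 3" using M assms by simp
  finally have r: "\<bar>r\<bar> \<le> M * h ^ 3" .
  have "(f 0 (x + s * h) - f 0 x) / h - (s * f 1 x + h / 2 * f 2 x) = r / h"
    using assms s by (simp add: r_def eval_nat_numeral field_simps)
  also have "\<bar>\<dots>\<bar> \<le> M * h ^ 3 / h"
    using r assms by (simp add: divide_right_mono)
  also have "\<dots> = M * h\<^sup>2" using assms by (simp add: eval_nat_numeral)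
  finally show ?thesis .
qed

section \<open>The difference quotient of the nonlinearity\<close>

lemma diff_quot_midpoint:
  assumes "\<And>x. (F has_real_derivative F' x) (at x)" "\<And>x. (F' has_real_derivative F'' x) (at x)"
    and "\<And>x. (F'' has_real_derivative F''' x) (at x)"
    and M: "\<And>x. \<bar>x\<bar> \<le> R \<Longrightarrow> \<bar>F''' x\<bar> \<le> M" and ab: "\<bar>a\<bar> \<le> R" "\<bar>b\<bar> \<le> R"
  shows "\<bar>diff_quot F a b - F' ((a + b) / 2)\<bar> \<le> M * (a - b)\<^sup>2"
proof (cases "a = b")
  case True
  then show ?thesis using assms(1)[of b] by (simp add: diff_quot_def DERIV_imp_deriv)
next
  case False
  define S where "S = {-R..R}"
  define m h where "m = (a + b) / 2" and "h = (a - b) / 2"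
  define f where "f i = (if i = 0 then F else if i = 1 then F' else if i = 2 then F'' else F''')" for i :: nat
  define r where "r y = F (m + y) - (F m + F' m * y + F'' m * y\<^sup>2 / 2)" for y
  have "(f i has_real_derivative f (Suc i) x) (at x within S)" if "i \<le> 2" for i x
  proof -
    have "i = 0 \<or> i = 1 \<or> i = 2" using that by auto
    then show ?thesis using assms(1-3)[of x]
      by (auto simp: f_def numeral_2_eq_2 intro: has_field_derivative_at_within)
  qed
  moreover have "m \<in> S" "m + h = a" "m - h = b" "a \<in> S" "b \<in> S"
    using ab by (auto simp: S_def m_def h_def field_simps abs_le_iff)
  ultimately have r: "\<bar>r y\<bar> \<le> M * \<bar>y\<bar> ^ 3 / 2" if "y = h \<or> y = - h" for y
    using real_Taylor[of S 2 f M m y] M that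
    by (auto simp: r_def f_def S_def eval_nat_numeral abs_le_iff)
  have M0: "M \<ge> 0" using M[of a] ab by fastforce
  have h: "h \<noteq> 0" using False by (simp add: h_def)
  \<comment> \<open>Expanding about the midpoint cancels the even terms, so only the cubic
    remainders survive and division by \<open>2 * h\<close> leaves second order.\<close>
  have "F a - F b = 2 * h * F' m + (r h - r (- h))"
    using \<open>m + h = a\<close> \<open>m - h = b\<close> by (simp add: r_def)
  moreover have "a - b = 2 * h" by (simp add: h_def)
  ultimately have "diff_quot F a b - F' m = (r h - r (- h)) / (2 * h)"
    using False h by (simp add: diff_quot_def field_simps)
  also have "\<bar>\<dots>\<bar> = \<bar>r h - r (- h)\<bar> / (2 * \<bar>h\<bar>)" by (simp add: abs_mult)
  also have "\<dots> \<le> (M * \<bar>h\<bar> ^ 3) / (2 * \<bar>h\<bar>)"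
    using r[of h] r[of "- h"] abs_triangle_ineq4[of "r h" "r (- h)"]
    by (intro divide_right_mono) auto
  also have "\<dots> = M * h\<^sup>2 / 2" using h by (simp add: eval_nat_numeral)
  also have "\<dots> = M * (a - b)\<^sup>2 / 8" by (simp add: h_def power_divide)
  also have "\<dots> \<le> M * (a - b)\<^sup>2" using M0 by simp
  finally show ?thesis by (simp add: m_def)
qed

text \<open>The integral representation gives the Lipschitz constant \<open>M / 2\<close> in each argument, which the bound
  on the time step needs.\<close>

lemma diff_quot_has_integral:
  assumes F: "\<And>x. (F has_real_derivative F' x) (at x)"
  shows "((\<lambda>s. F' (b + s * (a - b))) has_integral diff_quot F a b) {0..1}"
proof (cases "a = b")
  case True
  then show ?thesis
    using has_integral_const_real[of "F' b" 0 1] F[of b] by (simp add: diff_quot_def DERIV_imp_deriv)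
next
  case False
  have "((\<lambda>s. F (b + s * (a - b)) / (a - b)) has_real_derivative F' (b + s * (a - b))) (at s within {0..1})" for s
    using False by (auto intro!: derivative_eq_intros DERIV_chain2[OF F])
  then have "((\<lambda>s. F' (b + s * (a - b))) has_integral
      (F (b + 1 * (a - b)) / (a - b) - F (b + 0 * (a - b)) / (a - b))) {0..1}"
    by (intro fundamental_theorem_of_calculus)
      (auto simp: has_real_derivative_iff_has_vector_derivative[symmetric])
  then show ?thesis using False by (simp add: diff_quot_def diff_divide_distrib)
qed

lemma Lipschitz_if_bounded_deriv:
  assumes "\<And>x. (G has_real_derivative G' x) (at x)" "\<And>x. \<bar>x\<bar> \<le> R \<Longrightarrow> \<bar>G' x\<bar> \<le> M"
    and "\<bar>x\<bar> \<le> R" "\<bar>y\<bar> \<le> R"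
  shows "\<bar>G x - G y\<bar> \<le> M * \<bar>x - y\<bar>"
  using field_differentiable_bound[of "{-R..R}" G G' M x y] assms
  by (auto intro: has_field_derivative_at_within simp: abs_le_iff)

lemma diff_quot_Lipschitz:
  assumes F: "\<And>x. (F has_real_derivative F' x) (at x)" and F': "\<And>x. (F' has_real_derivative F'' x) (at x)"
    and M: "\<And>x. \<bar>x\<bar> \<le> R \<Longrightarrow> \<bar>F'' x\<bar> \<le> M"
    and R: "\<bar>a\<bar> \<le> R" "\<bar>b\<bar> \<le> R" "\<bar>c\<bar> \<le> R" "\<bar>d\<bar> \<le> R"
  shows "\<bar>diff_quot F a b - diff_quot F c d\<bar> \<le> M / 2 * (\<bar>a - c\<bar> + \<bar>b - d\<bar>)"
proof -
  define \<phi> where "\<phi> s = F' (b + s * (a - b)) - F' (d + s * (c - d))" for s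
  \<comment> \<open>This majorant is \<open>M\<close> times the linear interpolation of
    \<open>\<bar>b - d\<bar>\<close> and \<open>\<bar>a - c\<bar>\<close>. Both interpolation
    weights have integral 1/2 over the unit interval, which is the source of
    \<open>M / 2\<close>.\<close>
  define \<psi> where "\<psi> s = M * (\<bar>b - d\<bar> + s * (\<bar>a - c\<bar> - \<bar>b - d\<bar>))" for s
  have \<phi>: "(\<phi> has_integral diff_quot F a b - diff_quot F c d) {0..1}"
    unfolding \<phi>_def by (intro has_integral_diff diff_quot_has_integral F)
  have "((\<lambda>s. M * (s * \<bar>b - d\<bar> + s\<^sup>2 / 2 * (\<bar>a - c\<bar> - \<bar>b - d\<bar>))) has_real_derivative \<psi> s)
      (at s within {0..1})" for s
    unfolding \<psi>_def by (auto intro!: derivative_eq_intros)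
  then have "(\<psi> has_integral M * (1 * \<bar>b - d\<bar> + 1\<^sup>2 / 2 * (\<bar>a - c\<bar> - \<bar>b - d\<bar>))
      - M * (0 * \<bar>b - d\<bar> + 0\<^sup>2 / 2 * (\<bar>a - c\<bar> - \<bar>b - d\<bar>))) {0..1}"
    by (intro fundamental_theorem_of_calculus)
      (auto simp: has_real_derivative_iff_has_vector_derivative[symmetric])
  then have \<psi>: "(\<psi> has_integral M / 2 * (\<bar>a - c\<bar> + \<bar>b - d\<bar>)) {0..1}"
    by (simp add: field_simps)
  have M0: "M \<ge> 0" using M[of a] R by fastforce
  have bound: "\<bar>\<phi> s\<bar> \<le> \<psi> s" if s: "s \<in> {0..1}" for s
  proof -
    have conv: "\<bar>y + s * (x - y)\<bar> \<le> s * \<bar>x\<bar> + (1 - s) * \<bar>y\<bar>" for x y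
    proof -
      have "y + s * (x - y) = s * x + (1 - s) * y" by (simp add: algebra_simps)
      then show ?thesis using abs_triangle_ineq[of "s * x" "(1 - s) * y"] s by (simp add: abs_mult)
    qed
    have ball: "\<bar>y + s * (x - y)\<bar> \<le> R" if "\<bar>x\<bar> \<le> R" "\<bar>y\<bar> \<le> R" for x y
    proof -
      have "s * \<bar>x\<bar> + (1 - s) * \<bar>y\<bar> \<le> s * R + (1 - s) * R"
        using that s by (intro add_mono mult_left_mono) auto
      then show ?thesis using conv[of y x] by (simp add: algebra_simps)
    qed
    have "\<bar>\<phi> s\<bar> \<le> M * \<bar>(b + s * (a - b)) - (d + s * (c - d))\<bar>"
      unfolding \<phi>_def by (rule Lipschitz_if_bounded_deriv[OF F' M]) (auto intro!: ball R)
    also have "(b + s * (a - b)) - (d + s * (c - d)) = (b - d) + s * ((a - c) - (b - d))"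
      by (simp add: algebra_simps)
    also have "M * \<bar>\<dots>\<bar> \<le> M * (s * \<bar>a - c\<bar> + (1 - s) * \<bar>b - d\<bar>)"
      using conv[of "b - d" "a - c"] M0 by (rule mult_left_mono)
    also have "\<dots> = \<psi> s" by (simp add: \<psi>_def algebra_simps)
    finally show ?thesis .
  qed
  have "diff_quot F a b - diff_quot F c d \<le> M / 2 * (\<bar>a - c\<bar> + \<bar>b - d\<bar>)"
    by (rule has_integral_le[OF \<phi> \<psi>]) (use bound in \<open>fastforce simp: abs_le_iff\<close>)
  moreover have "- (diff_quot F a b - diff_quot F c d) \<le> M / 2 * (\<bar>a - c\<bar> + \<bar>b - d\<bar>)"
    by (rule has_integral_le[OF has_integral_neg[OF \<phi>] \<psi>]) (use bound in \<open>fastforce simp: abs_le_iff\<close>)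
  ultimately show ?thesis by (rule abs_leI)
qed

section \<open>Smoothness classes and the equation on the closed space interval\<close>

lemma maxabs_upper:
  assumes "continuous_on UNIV G" "\<bar>x\<bar> \<le> R"
  shows "\<bar>G x\<bar> \<le> maxabs G R"
proof -
  have "{\<xi>. \<bar>\<xi>\<bar> \<le> R} = {-R..R}" by auto
  moreover have "compact ((\<lambda>\<xi>. \<bar>G \<xi>\<bar>) ` {-R..R})"
    by (intro compact_continuous_image continuous_intros continuous_on_subset[OF assms(1)]) auto
  ultimately show ?thesis
    unfolding maxabs_def using assms(2)
    by (intro cSUP_upper) (auto dest: compact_imp_bounded bounded_imp_bdd_above)
qed

lemma C3_derivatives:
  assumes "Ck_on 3 UNIV F"
  obtains F''' where "\<And>x. (F has_real_derivative deriv F x) (at x)"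
    "\<And>x. (deriv F has_real_derivative deriv (deriv F) x) (at x)"
    "\<And>x. (deriv (deriv F) has_real_derivative F''' x) (at x)" "continuous_on UNIV F'''"
proof -
  have "(\<lambda>x. vector_derivative f (at x)) = deriv f" for f :: "real \<Rightarrow> real"
    by (rule ext) (simp add: field_derivative_eq_vector_derivative)
  then have *: "F differentiable_on UNIV" "deriv F differentiable_on UNIV"
      "deriv (deriv F) differentiable_on UNIV" "continuous_on UNIV (deriv (deriv (deriv F)))"
    using assms by (simp_all add: eval_nat_numeral)
  have "(f has_real_derivative deriv f x) (at x)" if "f differentiable_on UNIV" for f :: "real \<Rightarrow> real" and x
    using that by (simp add: differentiable_on_def DERIV_deriv_iff_real_differentiable)
  with * show thesis by (intro that) auto
qed

lemma Ck_rect_continuous: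
  "Ck_rect k T L u \<Longrightarrow> continuous_on ({0..T} \<times> {0..L}) (\<lambda>(t, x). u t x)"
  by (cases k) auto

lemma Ck_rect_bounded:
  assumes "Ck_rect k T L u"
  obtains M where "M \<ge> 0" "\<And>t x. t \<in> {0..T} \<Longrightarrow> x \<in> {0..L} \<Longrightarrow> \<bar>u t x\<bar> \<le> M"
proof -
  have "compact ((\<lambda>(t, x). u t x) ` ({0..T} \<times> {0..L}))"
    by (intro compact_continuous_image compact_Times Ck_rect_continuous[OF assms]) auto
  then obtain M where "M > 0" "\<forall>y \<in> (\<lambda>(t, x). u t x) ` ({0..T} \<times> {0..L}). norm y \<le> M"
    using compact_imp_bounded bounded_pos by blast
  then show thesis by (intro that[of M]) auto
qed

lemma Ck_rect_pd_x: "Ck_rect (i + k) T L u \<Longrightarrow> Ck_rect k T L ((pd_x L ^^ i) u)"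
  by (induction i arbitrary: u) (simp_all add: funpow_swap1)

lemma Ck_rect_pd_t: "Ck_rect (i + k) T L u \<Longrightarrow> Ck_rect k T L ((pd_t T ^^ i) u)"
  by (induction i arbitrary: u) (simp_all add: funpow_swap1)

lemma pd_x_funpow_deriv:
  assumes "Ck_rect k T L u" "i < k" "t \<in> {0..T}" "x \<in> {0..L}"
  shows "((pd_x L ^^ i) u t has_real_derivative (pd_x L ^^ Suc i) u t x) (at x within {0..L})"
proof -
  have "Ck_rect (Suc (k - Suc i)) T L ((pd_x L ^^ i) u)"
    using assms by (intro Ck_rect_pd_x) simp
  then have "(\<lambda>x. (pd_x L ^^ i) u t x) differentiable (at x within {0..L})"
    using assms by (simp add: differentiable_on_def)
  then show ?thesis
    by (simp add: vector_derivative_works has_real_derivative_iff_has_vector_derivative pd_x_def)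
qed

lemma pd_t_funpow_deriv:
  assumes "Ck_rect k T L u" "i < k" "t \<in> {0..T}" "x \<in> {0..L}"
  shows "((\<lambda>t. (pd_t T ^^ i) u t x) has_real_derivative (pd_t T ^^ Suc i) u t x) (at t within {0..T})"
proof -
  have "Ck_rect (Suc (k - Suc i)) T L ((pd_t T ^^ i) u)"
    using assms by (intro Ck_rect_pd_t) simp
  then have "(\<lambda>t. (pd_t T ^^ i) u t x) differentiable (at t within {0..T})"
    using assms by (simp add: differentiable_on_def)
  then show ?thesis
    by (simp add: vector_derivative_works has_real_derivative_iff_has_vector_derivative pd_t_def)
qed

text \<open>At a fixed interior time all terms are continuous on \<open>{0..L}\<close> and the open
  interval is dense in it. The truncation error at a wall needs the wave equation there in addition
  to the boundary condition.\<close>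

lemma pde_up_to_boundary:
  assumes "L > 0" and u: "Ck_rect 2 T L u" and "solves_ibvp T L F u" and F: "continuous_on UNIV (deriv F)"
    and t: "t \<in> {0<..<T}" and x: "x \<in> {0..L}"
  shows "pd_t T (pd_t T u) t x = pd_x L (pd_x L u) t x - deriv F (u t x)"
proof -
  have slice: "continuous_on {0..L} (\<lambda>x. w t x)"
    if "continuous_on ({0..T} \<times> {0..L}) (\<lambda>(t, x). w t x)" for w :: "real \<Rightarrow> real \<Rightarrow> real"
  proof -
    have "continuous_on {0..L} (\<lambda>x. (t, x))" by (intro continuous_intros)
    moreover have "Pair t ` {0..L} \<subseteq> {0..T} \<times> {0..L}" using t by auto
    ultimately show ?thesis using continuous_on_compose2[OF that, of "{0..L}" "Pair t"] by simp
  qed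
  have c: "continuous_on {0..L} (\<lambda>x. pd_t T (pd_t T u) t x)" "continuous_on {0..L} (\<lambda>x. pd_x L (pd_x L u) t x)"
    "continuous_on {0..L} (\<lambda>x. u t x)"
    using u by (auto intro!: slice simp: numeral_2_eq_2)
  have "continuous_on {0..L} (\<lambda>x. pd_t T (pd_t T u) t x - (pd_x L (pd_x L u) t x - deriv F (u t x)))"
    by (intro continuous_intros c continuous_on_compose2[OF F]) auto
  moreover have "closure {0<..<L} = {0..L}" using \<open>L > 0\<close> by simp
  moreover have "pd_t T (pd_t T u) t y - (pd_x L (pd_x L u) t y - deriv F (u t y)) = 0"
    if "y \<in> {0<..<L}" for y
    using assms(3) t that by (simp add: solves_ibvp_def)
  ultimately have "pd_t T (pd_t T u) t x - (pd_x L (pd_x L u) t x - deriv F (u t x)) = 0"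
    using x continuous_constant_on_closure[of "{0<..<L}"
        "\<lambda>x. pd_t T (pd_t T u) t x - (pd_x L (pd_x L u) t x - deriv F (u t x))" 0 x] by simp
  then show ?thesis by simp
qed

section \<open>Consistency and convergence\<close>

lemma pd_t_funpow_bounded:
  assumes "Ck_rect k T L u" "i \<le> k"
  shows "\<exists>M\<ge>0. \<forall>t\<in>{0..T}. \<forall>x\<in>{0..L}. \<bar>(pd_t T ^^ i) u t x\<bar> \<le> M"
proof -
  have "Ck_rect (k - i) T L ((pd_t T ^^ i) u)"
    using assms by (intro Ck_rect_pd_t) simp
  then show ?thesis by (meson Ck_rect_bounded)
qed

lemma pd_x_funpow_bounded:
  assumes "Ck_rect k T L u" "i \<le> k"
  shows "\<exists>M\<ge>0. \<forall>t\<in>{0..T}. \<forall>x\<in>{0..L}. \<bar>(pd_x L ^^ i) u t x\<bar> \<le> M"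
proof -
  have "Ck_rect (k - i) T L ((pd_x L ^^ i) u)"
    using assms by (intro Ck_rect_pd_x) simp
  then show ?thesis by (meson Ck_rect_bounded)
qed

text \<open>The constant is fixed before \<open>h\<close>, \<open>t\<close> and \<open>x\<close>: it
  bounds the fourth time derivative on the compact rectangle and so serves every grid. The next
  lemmas obtain theirs in the same way.\<close>

lemma time_second_difference:
  assumes "Ck_rect 4 T L u"
  obtains c where "c \<ge> 0" "\<And>h t x. h > 0 \<Longrightarrow> 0 \<le> t - h \<Longrightarrow> t + h \<le> T \<Longrightarrow> x \<in> {0..L} \<Longrightarrow>
    \<bar>(u (t + h) x - 2 * u t x + u (t - h) x) / h\<^sup>2 - pd_t T (pd_t T u) t x\<bar> \<le> c * h\<^sup>2"
proof -
  obtain M where M: "M \<ge> 0" "\<forall>t\<in>{0..T}. \<forall>x\<in>{0..L}. \<bar>(pd_t T ^^ 4) u t x\<bar> \<le> M"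
    using pd_t_funpow_bounded[OF assms, of 4] by (simp, blast)
  show thesis
  proof (rule that[OF M(1)])
    fix h t x :: real assume h: "h > 0" "0 \<le> t - h" "t + h \<le> T" "x \<in> {0..L}"
    define f where "f = (\<lambda>i t. (pd_t T ^^ i) u t x)"
    have "\<bar>(f 0 (t + h) - 2 * f 0 t + f 0 (t - h)) / h\<^sup>2 - f 2 t\<bar> \<le> M * h\<^sup>2"
    proof (rule second_difference_bound[of "{0..T}"])
      show "(f i has_real_derivative f (Suc i) y) (at y within {0..T})" if "y \<in> {0..T}" "i \<le> 3" for i y
        unfolding f_def by (rule pd_t_funpow_deriv[OF assms]) (use that h in auto)
      show "\<bar>f 4 y\<bar> \<le> M" if "y \<in> {0..T}" for y
        using M(2) that h unfolding f_def by simp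
    qed (use h in auto)
    then show "\<bar>(u (t + h) x - 2 * u t x + u (t - h) x) / h\<^sup>2 - pd_t T (pd_t T u) t x\<bar> \<le> M * h\<^sup>2"
      by (simp add: f_def numeral_2_eq_2)
  qed
qed

lemma space_second_difference:
  assumes "Ck_rect 4 T L u"
  obtains c where "c \<ge> 0" "\<And>h t x. h > 0 \<Longrightarrow> 0 \<le> x - h \<Longrightarrow> x + h \<le> L \<Longrightarrow> t \<in> {0..T} \<Longrightarrow>
    \<bar>(u t (x + h) - 2 * u t x + u t (x - h)) / h\<^sup>2 - pd_x L (pd_x L u) t x\<bar> \<le> c * h\<^sup>2"
proof -
  obtain M where M: "M \<ge> 0" "\<forall>t\<in>{0..T}. \<forall>x\<in>{0..L}. \<bar>(pd_x L ^^ 4) u t x\<bar> \<le> M"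
    using pd_x_funpow_bounded[OF assms, of 4] by (simp, blast)
  show thesis
  proof (rule that[OF M(1)])
    fix h t x :: real assume h: "h > 0" "0 \<le> x - h" "x + h \<le> L" "t \<in> {0..T}"
    define f where "f = (\<lambda>i. (pd_x L ^^ i) u t)"
    have "\<bar>(f 0 (x + h) - 2 * f 0 x + f 0 (x - h)) / h\<^sup>2 - f 2 x\<bar> \<le> M * h\<^sup>2"
    proof (rule second_difference_bound[of "{0..L}"])
      show "(f i has_real_derivative f (Suc i) y) (at y within {0..L})" if "y \<in> {0..L}" "i \<le> 3" for i y
        unfolding f_def by (rule pd_x_funpow_deriv[OF assms]) (use that h in auto)
      show "\<bar>f 4 y\<bar> \<le> M" if "y \<in> {0..L}" for y
        using M(2) that h unfolding f_def by simp
    qed (use h in auto)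
    then show "\<bar>(u t (x + h) - 2 * u t x + u t (x - h)) / h\<^sup>2 - pd_x L (pd_x L u) t x\<bar> \<le> M * h\<^sup>2"
      by (simp add: f_def numeral_2_eq_2)
  qed
qed

lemma space_difference_quotient:
  assumes "Ck_rect 4 T L u"
  obtains c where "c \<ge> 0" "\<And>h s t x. h > 0 \<Longrightarrow> \<bar>s\<bar> = 1 \<Longrightarrow> x \<in> {0..L} \<Longrightarrow> x + s * h \<in> {0..L} \<Longrightarrow> t \<in> {0..T} \<Longrightarrow>
    \<bar>(u t (x + s * h) - u t x) / h - (s * pd_x L u t x + h / 2 * pd_x L (pd_x L u) t x)\<bar> \<le> c * h\<^sup>2"
proof -
  obtain M where M: "M \<ge> 0" "\<forall>t\<in>{0..T}. \<forall>x\<in>{0..L}. \<bar>(pd_x L ^^ 3) u t x\<bar> \<le> M"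
    using pd_x_funpow_bounded[OF assms, of 3] by (simp, blast)
  show thesis
  proof (rule that[OF M(1)])
    fix h s t x :: real
    assume h: "h > 0" "\<bar>s\<bar> = 1" "x \<in> {0..L}" "x + s * h \<in> {0..L}" "t \<in> {0..T}"
    define f where "f = (\<lambda>i. (pd_x L ^^ i) u t)"
    have "\<bar>(f 0 (x + s * h) - f 0 x) / h - (s * f 1 x + h / 2 * f 2 x)\<bar> \<le> M * h\<^sup>2"
    proof (rule difference_quotient_bound[of "{0..L}"])
      show "(f i has_real_derivative f (Suc i) y) (at y within {0..L})" if "y \<in> {0..L}" "i \<le> 2" for i y
        unfolding f_def by (rule pd_x_funpow_deriv[OF assms]) (use that h in auto)
      show "\<bar>f 3 y\<bar> \<le> M" if "y \<in> {0..L}" for y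
        using M(2) that h unfolding f_def by simp
    qed (use h in auto)
    then show "\<bar>(u t (x + s * h) - u t x) / h - (s * pd_x L u t x + h / 2 * pd_x L (pd_x L u) t x)\<bar> \<le> M * h\<^sup>2"
      by (simp add: f_def numeral_2_eq_2)
  qed
qed

text \<open>Stated for general \<open>w\<close> because it is applied to \<open>u\<close> and to its
  first and second space derivatives. The latter has just the two derivatives left that
  \<open>k \<ge> 2\<close> asks for.\<close>

lemma time_average:
  assumes "Ck_rect k T L w" "k \<ge> 2"
  obtains c where "c \<ge> 0" "\<And>h t x. h > 0 \<Longrightarrow> 0 \<le> t - h \<Longrightarrow> t + h \<le> T \<Longrightarrow> x \<in> {0..L} \<Longrightarrow>
    \<bar>(w (t + h) x + w (t - h) x) / 2 - w t x\<bar> \<le> c * h\<^sup>2"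
proof -
  obtain M where M: "M \<ge> 0" "\<forall>t\<in>{0..T}. \<forall>x\<in>{0..L}. \<bar>(pd_t T ^^ 2) w t x\<bar> \<le> M"
    using pd_t_funpow_bounded[OF assms] by blast
  show thesis
  proof (rule that[OF M(1)])
    fix h t x :: real assume h: "h > 0" "0 \<le> t - h" "t + h \<le> T" "x \<in> {0..L}"
    define f where "f = (\<lambda>i t. (pd_t T ^^ i) w t x)"
    have "\<bar>(f 0 (t + h) + f 0 (t - h)) / 2 - f 0 t\<bar> \<le> M * h\<^sup>2"
    proof (rule symmetric_average_bound[of "{0..T}"])
      show "(f i has_real_derivative f (Suc i) y) (at y within {0..T})" if "y \<in> {0..T}" "i \<le> 1" for i y
        unfolding f_def by (rule pd_t_funpow_deriv[OF assms(1)]) (use that h assms(2) in auto)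
      show "\<bar>f 2 y\<bar> \<le> M" if "y \<in> {0..T}" for y
        using M(2) that h unfolding f_def by simp
    qed (use h in auto)
    then show "\<bar>(w (t + h) x + w (t - h) x) / 2 - w t x\<bar> \<le> M * h\<^sup>2"
      by (simp add: f_def)
  qed
qed

text \<open>Two errors of second order add up. Replacing the quotient by \<open>deriv F\<close> at
  the mean of the outer values costs the square of their distance, which is of order
  \<open>h\<close> as the time derivative of \<open>u\<close> is bounded; replacing that mean by the
  middle value costs a time average error.\<close>

lemma diff_quot_consistency:
  assumes u: "Ck_rect 4 T L u" and F: "Ck_on 3 UNIV F"
  obtains c where "c \<ge> 0" "\<And>h t x. h > 0 \<Longrightarrow> 0 \<le> t - h \<Longrightarrow> t + h \<le> T \<Longrightarrow> x \<in> {0..L} \<Longrightarrow>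
    \<bar>diff_quot F (u (t + h) x) (u (t - h) x) - deriv F (u t x)\<bar> \<le> c * h\<^sup>2"
proof -
  obtain F''' where F1: "\<And>x. (F has_real_derivative deriv F x) (at x)"
    and F2: "\<And>x. (deriv F has_real_derivative deriv (deriv F) x) (at x)"
    and F3: "\<And>x. (deriv (deriv F) has_real_derivative F''' x) (at x)" and F3c: "continuous_on UNIV F'''"
    by (rule C3_derivatives[OF F]) (rule that)
  have F2c: "continuous_on UNIV (deriv (deriv F))"
    using F3 by (meson DERIV_continuous_on has_field_derivative_at_within)
  obtain R where R0: "R \<ge> 0" and R: "\<And>t x. t \<in> {0..T} \<Longrightarrow> x \<in> {0..L} \<Longrightarrow> \<bar>u t x\<bar> \<le> R"
    by (rule Ck_rect_bounded[OF u]) (rule that)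
  obtain M where M0: "M \<ge> 0" and M: "\<forall>t\<in>{0..T}. \<forall>x\<in>{0..L}. \<bar>pd_t T u t x\<bar> \<le> M"
    using pd_t_funpow_bounded[OF u, of 1] by (simp, blast)
  obtain c where c0: "c \<ge> 0" and c: "\<And>h t x. h > 0 \<Longrightarrow> 0 \<le> t - h \<Longrightarrow> t + h \<le> T \<Longrightarrow> x \<in> {0..L} \<Longrightarrow>
    \<bar>(u (t + h) x + u (t - h) x) / 2 - u t x\<bar> \<le> c * h\<^sup>2"
    by (rule time_average[OF u]) (simp, rule that)
  define m2 m3 where "m2 = maxabs (deriv (deriv F)) R" and "m3 = maxabs F''' R"
  have m2: "\<bar>deriv (deriv F) \<xi>\<bar> \<le> m2" and m3: "\<bar>F''' \<xi>\<bar> \<le> m3" if "\<bar>\<xi>\<bar> \<le> R" for \<xi>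
    using that maxabs_upper F2c F3c by (auto simp: m2_def m3_def)
  have m0: "m2 \<ge> 0" "m3 \<ge> 0" using m2[of 0] m3[of 0] R0 by auto
  show thesis
  proof (rule that)
    show "m3 * (2 * M)\<^sup>2 + m2 * c \<ge> 0" using m0 c0 by simp
    fix h t x :: real assume h: "h > 0" "0 \<le> t - h" "t + h \<le> T" "x \<in> {0..L}"
    define a b where "a = u (t + h) x" and "b = u (t - h) x"
    have ab: "\<bar>a\<bar> \<le> R" "\<bar>b\<bar> \<le> R" "\<bar>u t x\<bar> \<le> R" using h R by (auto simp: a_def b_def)
    have "\<bar>a - b\<bar> \<le> M * \<bar>(t + h) - (t - h)\<bar>"
    proof -
      have "((\<lambda>t. u t x) has_real_derivative pd_t T u y x) (at y within {0..T})" if "y \<in> {0..T}" for y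
        using pd_t_funpow_deriv[OF u, of 0 y x] that h by simp
      then show ?thesis
        using field_differentiable_bound[of "{0..T}" "\<lambda>t. u t x" "\<lambda>t. pd_t T u t x" M "t - h" "t + h"] h M
        by (simp add: a_def b_def)
    qed
    then have "\<bar>a - b\<bar> \<le> 2 * M * h" using h by simp
    then have "\<bar>a - b\<bar>\<^sup>2 \<le> (2 * M * h)\<^sup>2" by (intro power_mono) auto
    then have "m3 * (a - b)\<^sup>2 \<le> m3 * ((2 * M)\<^sup>2 * h\<^sup>2)"
      using m0 by (intro mult_left_mono) (simp_all add: power_mult_distrib)
    moreover have "\<bar>diff_quot F a b - deriv F ((a + b) / 2)\<bar> \<le> m3 * (a - b)\<^sup>2"
      by (rule diff_quot_midpoint[OF F1 F2 F3 m3 ab(1,2)])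
    moreover have "\<bar>deriv F ((a + b) / 2) - deriv F (u t x)\<bar> \<le> m2 * (c * h\<^sup>2)"
    proof -
      have "\<bar>(a + b) / 2\<bar> \<le> R" using ab by (auto simp: abs_le_iff)
      then have "\<bar>deriv F ((a + b) / 2) - deriv F (u t x)\<bar> \<le> m2 * \<bar>(a + b) / 2 - u t x\<bar>"
        using ab by (intro Lipschitz_if_bounded_deriv[OF F2 m2])
      also have "\<dots> \<le> m2 * (c * h\<^sup>2)"
        unfolding a_def b_def using c[OF h] m0 by (intro mult_left_mono)
      finally show ?thesis .
    qed
    ultimately have "\<bar>diff_quot F a b - deriv F (u t x)\<bar> \<le> m3 * ((2 * M)\<^sup>2 * h\<^sup>2) + m2 * (c * h\<^sup>2)"
      by linarith
    then show "\<bar>diff_quot F (u (t + h) x) (u (t - h) x) - deriv F (u t x)\<bar>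
        \<le> (m3 * (2 * M)\<^sup>2 + m2 * c) * h\<^sup>2"
      by (simp add: a_def b_def algebra_simps)
  qed
qed

text \<open>Meant for a spatial difference \<open>X\<close>, \<open>X'\<close> at the two outer
  times, the derivatives \<open>Y\<close>, \<open>Y'\<close> it approximates there, and the
  derivative \<open>Z\<close> at the middle time: spatial error and time averaging error
  add.\<close>

lemma abs_avg_diff_le:
  fixes X Y :: real
  assumes "\<bar>X - Y\<bar> \<le> a" "\<bar>X' - Y'\<bar> \<le> a" "\<bar>(Y + Y') / 2 - Z\<bar> \<le> b"
  shows "\<bar>(X + X') / 2 - Z\<bar> \<le> a + b"
  using assms by argo

text \<open>The bound is weighted by \<open>mass\<close> and not by \<open>wt\<close>: at the walls
  the boundary condition contributes a defect without a factor \<open>dx\<close>, which the weight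
  \<open>wt\<close> could not absorb uniformly in the grid.\<close>

lemma scheme_consistency:
  assumes T: "T > 0" and L: "L > 0" and F: "Ck_on 3 UNIV F" and u: "Ck_rect 4 T L u"
    and sol: "solves_ibvp T L F u"
  obtains c where "c \<ge> 0"
    "\<And>N K n k dt dx. N > 0 \<Longrightarrow> K > 0 \<Longrightarrow> n \<in> {1..<N} \<Longrightarrow> k \<in> {0..int K} \<Longrightarrow>
       dt = T / real N \<Longrightarrow> dx = L / real K \<Longrightarrow>
       \<bar>resid dt dx K F (grid dt dx u) n k\<bar> \<le> mass dx K k * (c * (dx\<^sup>2 + dt\<^sup>2))"
proof -
  let ?utt = "pd_t T (pd_t T u)" and ?ux = "pd_x L u" and ?uxx = "pd_x L (pd_x L u)"
  have ux: "Ck_rect 3 T L ?ux" and uxx: "Ck_rect 2 T L ?uxx"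
    using u by (simp_all add: eval_nat_numeral)
  obtain c1 where c1: "c1 \<ge> 0" "\<And>h t x. h > 0 \<Longrightarrow> 0 \<le> t - h \<Longrightarrow> t + h \<le> T \<Longrightarrow> x \<in> {0..L} \<Longrightarrow>
    \<bar>(u (t + h) x - 2 * u t x + u (t - h) x) / h\<^sup>2 - ?utt t x\<bar> \<le> c1 * h\<^sup>2"
    by (rule time_second_difference[OF u]) (rule that)
  obtain c2 where c2: "c2 \<ge> 0" "\<And>h t x. h > 0 \<Longrightarrow> 0 \<le> x - h \<Longrightarrow> x + h \<le> L \<Longrightarrow> t \<in> {0..T} \<Longrightarrow>
    \<bar>(u t (x + h) - 2 * u t x + u t (x - h)) / h\<^sup>2 - ?uxx t x\<bar> \<le> c2 * h\<^sup>2"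
    by (rule space_second_difference[OF u]) (rule that)
  obtain c3 where c3: "c3 \<ge> 0" "\<And>h t x. h > 0 \<Longrightarrow> 0 \<le> t - h \<Longrightarrow> t + h \<le> T \<Longrightarrow> x \<in> {0..L} \<Longrightarrow>
    \<bar>(?uxx (t + h) x + ?uxx (t - h) x) / 2 - ?uxx t x\<bar> \<le> c3 * h\<^sup>2"
    by (rule time_average[OF uxx order_refl]) (rule that)
  obtain c4 where c4: "c4 \<ge> 0" "\<And>h s t x. h > 0 \<Longrightarrow> \<bar>s\<bar> = 1 \<Longrightarrow> x \<in> {0..L} \<Longrightarrow> x + s * h \<in> {0..L} \<Longrightarrow> t \<in> {0..T} \<Longrightarrow>
    \<bar>(u t (x + s * h) - u t x) / h - (s * ?ux t x + h / 2 * ?uxx t x)\<bar> \<le> c4 * h\<^sup>2"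
    by (rule space_difference_quotient[OF u]) (rule that)
  obtain c5 where c5: "c5 \<ge> 0" "\<And>h t x. h > 0 \<Longrightarrow> 0 \<le> t - h \<Longrightarrow> t + h \<le> T \<Longrightarrow> x \<in> {0..L} \<Longrightarrow>
    \<bar>(?ux (t + h) x + ?ux (t - h) x) / 2 - ?ux t x\<bar> \<le> c5 * h\<^sup>2"
    by (rule time_average[OF ux]) (simp, rule that)
  obtain c6 where c6: "c6 \<ge> 0" "\<And>h t x. h > 0 \<Longrightarrow> 0 \<le> t - h \<Longrightarrow> t + h \<le> T \<Longrightarrow> x \<in> {0..L} \<Longrightarrow>
    \<bar>diff_quot F (u (t + h) x) (u (t - h) x) - deriv F (u t x)\<bar> \<le> c6 * h\<^sup>2"
    by (rule diff_quot_consistency[OF u F]) (rule that)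
  have F1: "continuous_on UNIV (deriv F)"
    using C3_derivatives[OF F] by (metis DERIV_continuous_on has_field_derivative_at_within)
  define c where "c = c1 + c2 + c3 + c4 + c5 + c6"
  show thesis
  proof (rule that)
    show "c \<ge> 0" using c1(1) c2(1) c3(1) c4(1) c5(1) c6(1) by (simp add: c_def)
    fix N K n :: nat and k :: int and dt dx :: real
    assume N: "N > 0" and K: "K > 0" and n: "n \<in> {1..<N}" and k: "k \<in> {0..int K}"
      and dt_def: "dt = T / real N" and dx_def: "dx = L / real K"
    define v where "v = grid dt dx u"
    define t x where "t = real n * dt" and "x = real_of_int k * dx"
    have dt: "dt > 0" and dx: "dx > 0" and NT: "real N * dt = T" and KL: "real K * dx = L"
      using N K T L by (auto simp: dt_def dx_def)
    have n1: "real (n + 1) * dt = t + dt" "real (n - 1) * dt = t - dt"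
      using n by (auto simp: t_def of_nat_diff algebra_simps)
    \<comment> \<open>The range \<open>{1..<N}\<close> keeps both neighbouring times in the closed
      interval and puts \<open>t\<close> strictly inside, where the equation and the boundary
      conditions are available.\<close>
    have "1 * dt \<le> real n * dt" "real (n + 1) * dt \<le> real N * dt"
      using n dt by (intro mult_right_mono; simp)+
    then have t: "0 \<le> t - dt" "t + dt \<le> T" "t \<in> {0<..<T}" "t + dt \<in> {0..T}" "t - dt \<in> {0..T}"
      using dt NT n1 by (auto simp: t_def)
    have j: "real_of_int j * dx \<in> {0..L}" if "j \<in> {0..int K}" for j
    proof -
      have "real_of_int j * dx \<le> real K * dx" using that dx by (intro mult_right_mono) auto
      then show ?thesis using that dx KL by auto
    qed
    have x: "x \<in> {0..L}" using j[OF k] by (simp add: x_def)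
    have pde: "?utt t x = ?uxx t x - deriv F (u t x)"
      using u by (intro pde_up_to_boundary[OF L _ sol F1 t(3) x]) (simp add: eval_nat_numeral)
    have avg: "time_avg v n i = (u (t + dt) (real_of_int i * dx) + u (t - dt) (real_of_int i * dx)) / 2" for i
      unfolding time_avg_def v_def grid_def n1 ..
    define d2 where "d2 = dn_second dt v n k"
    define q where "q = diff_quot F (v (n + 1) k) (v (n - 1) k)"
    have d2: "\<bar>d2 - ?utt t x\<bar> \<le> c1 * dt\<^sup>2"
      using c1(2)[OF dt t(1,2) x] unfolding d2_def dn_second_def v_def grid_def n1 by (simp add: t_def x_def)
    have q: "\<bar>q - deriv F (u t x)\<bar> \<le> c6 * dt\<^sup>2"
      using c6(2)[OF dt t(1,2) x] unfolding q_def v_def grid_def n1 by (simp add: x_def)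
    have uxx_avg: "\<bar>(?uxx (t + dt) x + ?uxx (t - dt) x) / 2 - ?uxx t x\<bar> \<le> c3 * dt\<^sup>2"
      by (rule c3(2)[OF dt t(1,2) x])
    have res: "resid dt dx K F v n k = mass dx K k * d2
        - (flux dx K (time_avg v n) k - flux dx K (time_avg v n) (k - 1)) + wt dx K k * q"
      by (simp add: resid_def d2_def q_def)
    have h: "c1 * dt\<^sup>2 + c2 * dx\<^sup>2 + c3 * dt\<^sup>2 + c4 * dx\<^sup>2 + c5 * dt\<^sup>2 + c6 * dt\<^sup>2 \<le> c * (dx\<^sup>2 + dt\<^sup>2)"
      using c1(1) c2(1) c3(1) c4(1) c5(1) c6(1) by (simp add: c_def algebra_simps)
    \<comment> \<open>both walls at once: \<open>s\<close> is the direction of the inward normal\<close>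
    have wall: "\<bar>(1 + dx / 2) * d2 - (U' - U) / dx + dx / 2 * q\<bar> \<le> (1 + dx / 2) * (c * (dx\<^sup>2 + dt\<^sup>2))"
      if s: "\<bar>s\<bar> = 1" and bc: "?utt t x = s * ?ux t x" and y: "x + s * dx \<in> {0..L}"
        and U: "U = (u (t + dt) x + u (t - dt) x) / 2"
        and U': "U' = (u (t + dt) (x + s * dx) + u (t - dt) (x + s * dx)) / 2" for s U U'
    proof -
      let ?Y = "\<lambda>t. s * ?ux t x + dx / 2 * ?uxx t x"
      have "\<bar>(?Y (t + dt) + ?Y (t - dt)) / 2 - ?Y t\<bar> \<le> c5 * dt\<^sup>2 + dx / 2 * (c3 * dt\<^sup>2)"
      proof -
        have eq: "(?Y (t + dt) + ?Y (t - dt)) / 2 - ?Y t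
            = s * ((?ux (t + dt) x + ?ux (t - dt) x) / 2 - ?ux t x)
              + dx / 2 * ((?uxx (t + dt) x + ?uxx (t - dt) x) / 2 - ?uxx t x)"
          by (simp add: field_simps)
        have "\<bar>s * ((?ux (t + dt) x + ?ux (t - dt) x) / 2 - ?ux t x)\<bar> \<le> c5 * dt\<^sup>2"
          using c5(2)[OF dt t(1,2) x] s by (simp only: abs_mult mult_1)
        moreover have "\<bar>dx / 2 * ((?uxx (t + dt) x + ?uxx (t - dt) x) / 2 - ?uxx t x)\<bar> \<le> dx / 2 * (c3 * dt\<^sup>2)"
          unfolding abs_mult using uxx_avg dx by (simp add: mult_left_mono)
        ultimately show ?thesis unfolding eq by linarith
      qed
      with c4(2)[OF dx s x y t(4)] c4(2)[OF dx s x y t(5)]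
      have "\<bar>((u (t + dt) (x + s * dx) - u (t + dt) x) / dx + (u (t - dt) (x + s * dx) - u (t - dt) x) / dx) / 2
          - ?Y t\<bar> \<le> c4 * dx\<^sup>2 + (c5 * dt\<^sup>2 + dx / 2 * (c3 * dt\<^sup>2))"
        by (rule abs_avg_diff_le)
      moreover have "((u (t + dt) (x + s * dx) - u (t + dt) x) / dx + (u (t - dt) (x + s * dx) - u (t - dt) x) / dx) / 2
          = (U' - U) / dx"
        unfolding U U' using dx by (simp add: field_simps)
      ultimately have quot: "\<bar>(U' - U) / dx - ?Y t\<bar> \<le> c4 * dx\<^sup>2 + (c5 * dt\<^sup>2 + dx / 2 * (c3 * dt\<^sup>2))"
        by simp
      \<comment> \<open>All leading terms cancel: the boundary condition matches
        \<open>s * ?ux t x\<close> with the unit point mass, and \<open>dx / 2\<close> times the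
        wave equation matches the half cell. Only consistency errors remain.\<close>
      have "(1 + dx / 2) * d2 - (U' - U) / dx + dx / 2 * q
          = (1 + dx / 2) * (d2 - ?utt t x) - ((U' - U) / dx - ?Y t) + dx / 2 * (q - deriv F (u t x))"
        using bc pde by (simp add: algebra_simps)
      also have "\<bar>\<dots>\<bar> \<le> (1 + dx / 2) * (c1 * dt\<^sup>2) + (c4 * dx\<^sup>2 + (c5 * dt\<^sup>2 + dx / 2 * (c3 * dt\<^sup>2)))
          + dx / 2 * (c6 * dt\<^sup>2)"
      proof -
        have "\<bar>(1 + dx / 2) * (d2 - ?utt t x)\<bar> \<le> (1 + dx / 2) * (c1 * dt\<^sup>2)"
          unfolding abs_mult using d2 dx by (simp add: mult_left_mono)
        moreover have "\<bar>dx / 2 * (q - deriv F (u t x))\<bar> \<le> dx / 2 * (c6 * dt\<^sup>2)"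
          unfolding abs_mult using q dx by (simp add: mult_left_mono)
        ultimately show ?thesis using quot by linarith
      qed
      also have "\<dots> \<le> (1 + dx / 2) *
          (c1 * dt\<^sup>2 + c2 * dx\<^sup>2 + c3 * dt\<^sup>2 + c4 * dx\<^sup>2 + c5 * dt\<^sup>2 + c6 * dt\<^sup>2)"
      proof -
        have "a1 + (b + (d + z * a3)) + z * a6 \<le> (a1 + e + a3 + b + d + a6) + z * (e + a3 + b + d + a6)"
          if "0 \<le> z" "0 \<le> e" "0 \<le> a3" "0 \<le> b" "0 \<le> d" "0 \<le> a6" for a1 a3 a6 b d e z :: real
          using that by (simp add: algebra_simps)
        from this[of "dx / 2" "c2 * dx\<^sup>2" "c3 * dt\<^sup>2" "c4 * dx\<^sup>2" "c5 * dt\<^sup>2" "c6 * dt\<^sup>2" "(1 + dx / 2) * (c1 * dt\<^sup>2)"]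
        show ?thesis
          using c2(1) c3(1) c4(1) c5(1) c6(1) dx by (simp add: algebra_simps)
      qed
      also have "\<dots> \<le> (1 + dx / 2) * (c * (dx\<^sup>2 + dt\<^sup>2))"
        using h dx by (intro mult_left_mono) auto
      finally show ?thesis .
    qed
    consider "k = 0" | "k = int K" | "0 < k" "k < int K" using k by fastforce
    then have "\<bar>resid dt dx K F v n k\<bar> \<le> mass dx K k * (c * (dx\<^sup>2 + dt\<^sup>2))"
    proof cases
      case 1
      have "resid dt dx K F v n k = (1 + dx / 2) * d2
          - (time_avg v n 1 - time_avg v n 0) / dx + dx / 2 * q"
        unfolding res using 1 K by (simp add: mass_def wt_def flux_def dk_plus_def)
      moreover have "?utt t x = 1 * ?ux t x"
        using sol t 1 by (simp add: solves_ibvp_def x_def)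
      moreover have "x + 1 * dx \<in> {0..L}" using j[of 1] K 1 by (simp add: x_def)
      ultimately show ?thesis
        using wall[of 1 "time_avg v n 0" "time_avg v n 1"] 1 by (simp add: avg x_def mass_def)
    next
      case 2
      have xL: "x = L" using 2 KL by (simp add: x_def)
      have xd: "x + - 1 * dx = real_of_int (int K - 1) * dx" using 2 by (simp add: x_def algebra_simps)
      have "resid dt dx K F v n k = (1 + dx / 2) * d2
          - (time_avg v n (int K - 1) - time_avg v n (int K)) / dx + dx / 2 * q"
        unfolding res using 2 K by (simp add: mass_def wt_def flux_def dk_plus_def diff_divide_distrib)
      moreover have "?utt t x = - 1 * ?ux t x"
        using sol t unfolding xL by (simp add: solves_ibvp_def eq_neg_iff_add_eq_0)
      moreover have "x + - 1 * dx \<in> {0..L}" using j[of "int K - 1"] K unfolding xd by simp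
      moreover have "time_avg v n (int K) = (u (t + dt) x + u (t - dt) x) / 2"
        unfolding avg x_def 2 ..
      moreover have "time_avg v n (int K - 1) = (u (t + dt) (x + - 1 * dx) + u (t - dt) (x + - 1 * dx)) / 2"
        unfolding avg xd ..
      ultimately show ?thesis
        using wall[of "- 1" "time_avg v n (int K)" "time_avg v n (int K - 1)"] 2
        by (simp only: mass_def) simp
    next
      case 3
      have xp: "real_of_int (k + 1) * dx = x + dx" "real_of_int (k - 1) * dx = x - dx" "real_of_int k * dx = x"
        by (simp_all add: x_def algebra_simps)
      have xb: "0 \<le> x - dx" "x + dx \<le> L"
        using j[of "k + 1"] j[of "k - 1"] 3 unfolding xp by auto
      define D where "D = dk_second dx (time_avg v n) k"
      let ?X = "\<lambda>t. (u t (x + dx) - 2 * u t x + u t (x - dx)) / dx\<^sup>2"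
      have "\<bar>(?X (t + dt) + ?X (t - dt)) / 2 - ?uxx t x\<bar> \<le> c2 * dx\<^sup>2 + c3 * dt\<^sup>2"
        by (rule abs_avg_diff_le[OF c2(2)[OF dx xb t(4)] c2(2)[OF dx xb t(5)] uxx_avg])
      moreover have "(?X (t + dt) + ?X (t - dt)) / 2 = D"
        unfolding D_def dk_second_def avg xp using dx by (simp add: field_simps)
      ultimately have D: "\<bar>D - ?uxx t x\<bar> \<le> c2 * dx\<^sup>2 + c3 * dt\<^sup>2" by simp
      have "resid dt dx K F v n k = dx * (d2 - D + q)"
        unfolding res D_def using 3 dx
        by (simp add: mass_def wt_def flux_def dk_plus_def dk_second_def power2_eq_square field_simps)
      moreover have "\<bar>d2 - D + q\<bar> \<le> c * (dx\<^sup>2 + dt\<^sup>2)"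
      proof -
        have "0 \<le> c4 * dx\<^sup>2" "0 \<le> c5 * dt\<^sup>2" using c4(1) c5(1) by simp_all
        then show ?thesis using d2 D q pde h by linarith
      qed
      ultimately show ?thesis
        using 3 dx by (simp add: abs_mult mass_def mult_left_mono)
    qed
    then show "\<bar>resid dt dx K F (grid dt dx u) n k\<bar> \<le> mass dx K k * (c * (dx\<^sup>2 + dt\<^sup>2))"
      by (simp add: v_def)
  qed
qed

section \<open>From consistency to convergence\<close>

lemma energy_initial:
  assumes "\<And>k. k \<in> {0..int K} \<Longrightarrow> e 0 k = 0 \<and> e 1 k = 0"
  shows "energy dt dx K e 1 = 0"
  using assms by (simp add: energy_def dn_minus_def dk_plus_def)

lemma abs_le_norm_inf: "k \<in> {0..int K} \<Longrightarrow> \<bar>V k\<bar> \<le> norm_inf K V"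
  unfolding norm_inf_def by (intro Max_ge) auto

text \<open>Apart from \<open>s\<close> and \<open>A\<close>, the grid enters only through
  \<open>dx * real K\<close> and \<open>real N * dt\<close>, the length and the final time. The
  numbers are 32 = 8 * 4, from Gronwall and Young, and 14 = 16 * 7/8.\<close>

lemma energy_bound:
  fixes U V :: "nat \<Rightarrow> int \<Rightarrow> real"
  defines "e \<equiv> \<lambda>n k. U n k - V n k"
  assumes "A > 0" "dt > 0" "dx > 0" "K > 0" "dt * A \<le> 1"
    and init: "\<And>k. k \<in> {0..int K} \<Longrightarrow> U 0 k = V 0 k \<and> U 1 k = V 1 k"
    and U: "\<And>n k. n \<in> {1..<N} \<Longrightarrow> k \<in> {0..int K} \<Longrightarrow> resid dt dx K F U n k = 0"
    and V: "\<And>n k. n \<in> {1..<N} \<Longrightarrow> k \<in> {0..int K} \<Longrightarrow> \<bar>resid dt dx K F V n k\<bar> \<le> mass dx K k * s"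
    and q: "\<And>n k. n \<in> {1..<N} \<Longrightarrow> k \<in> {0..int K} \<Longrightarrow>
        \<bar>diff_quot F (U (n + 1) k) (U (n - 1) k) - diff_quot F (V (n + 1) k) (V (n - 1) k)\<bar>
        \<le> (A - 1) / 2 * (\<bar>e (n + 1) k\<bar> + \<bar>e (n - 1) k\<bar>)"
    and n: "n \<in> {1..N}"
  shows "energy dt dx K e n
    \<le> s\<^sup>2 * (32 / A * (dx * real K + 2) * (real N * dt) * exp (14 * A * (real N * dt)))"
proof -
  define b where "b = dt * ((dx * real K + 2) * (4 * s\<^sup>2 / A))"
  define z where "z = dt * (7 * A / 8)"
  have b: "b \<ge> 0" and z: "z \<ge> 0" "z \<le> 7 / 8"
    using \<open>A > 0\<close> \<open>dt > 0\<close> \<open>dx > 0\<close> \<open>dt * A \<le> 1\<close> by (auto simp: b_def z_def mult.commute)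
  have "energy dt dx K e n \<le> 8 * b * real n * exp (16 * z * real n)"
  proof (rule discrete_Gronwall[OF z b _ _ _ n])
    show "energy dt dx K e 1 = 0" using init by (intro energy_initial) (simp add: e_def)
    show "energy dt dx K e m \<ge> 0" for m using assms by (intro energy_nonneg) simp
    fix m assume m: "m \<in> {1..<N}"
    have "energy dt dx K e (m + 1) - energy dt dx K e m
     \<le> dt * (7 * A / 8 * (energy dt dx K e (m + 1) + energy dt dx K e m)
             + (dx * real K + 2) * (4 * s\<^sup>2 / A))"
      unfolding e_def using m \<open>A > 0\<close> \<open>dt > 0\<close> \<open>dx > 0\<close> \<open>K > 0\<close>
      by (intro energy_step[where F = F] U[OF m] V[OF m] q[OF m, unfolded e_def]) auto
    then show "energy dt dx K e (m + 1) - energy dt dx K e m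
        \<le> z * (energy dt dx K e (m + 1) + energy dt dx K e m) + b"
      by (simp only: b_def z_def distrib_left mult.assoc)
  qed
  also have "\<dots> \<le> 8 * b * real N * exp (16 * z * real N)"
    using n b z by (intro mult_mono) (auto intro!: mult_left_mono)
  also have "\<dots> = s\<^sup>2 * (32 / A * (dx * real K + 2) * (real N * dt) * exp (14 * A * (real N * dt)))"
    by (simp add: b_def z_def mult_ac)
  finally show ?thesis .
qed

theorem theorem5p1:
  fixes T L B :: real
    and F :: "real \<Rightarrow> real"
    and u :: "real \<Rightarrow> real \<Rightarrow> real"
  assumes "T > 0" and "L > 0"
    and "Ck_on 3 UNIV F"
    and "Ck_rect 4 T L u"
    and "solves_ibvp T L F u"
    and "Ck_on 4 {0..L} (\<lambda>x. u 0 x)"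
    and "Ck_on 3 {0..L} (\<lambda>x. pd_t T u 0 x)"
  shows "\<exists>C. \<forall>(N::nat) (K::nat) (U :: nat \<Rightarrow> int \<Rightarrow> real).
    let dt = T / real N;
        dx = L / real K;
        v = grid dt dx u;
        e = (\<lambda>n k. U n k - v n k);
        C1 = Max ((\<lambda>n. max (norm_inf K (U n)) (norm_inf K (v n))) ` {0..N})
    in N > 0 \<longrightarrow> K > 0 \<longrightarrow>
       solves_scheme dt dx N K F U \<longrightarrow>
       (\<forall>k\<in>{0..int K}. U 0 k = v 0 k \<and> U 1 k = v 1 k) \<longrightarrow>
       B < 1 / (1 + maxabs (deriv (deriv F)) C1) \<longrightarrow>
       dt < B \<longrightarrow>
       Max ((\<lambda>n. norm_2 dx K (dn_minus dt e n) + norm_H1 dx K (e n)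
                  + \<bar>dn_minus dt e n 0\<bar> + \<bar>dn_minus dt e n (int K)\<bar>) ` {1..N})
         \<le> C * (dx\<^sup>2 + dt\<^sup>2)"
proof -
  obtain c where c: "c \<ge> 0"
    "\<And>N K n k dt dx. N > 0 \<Longrightarrow> K > 0 \<Longrightarrow> n \<in> {1..<N} \<Longrightarrow> k \<in> {0..int K} \<Longrightarrow>
       dt = T / real N \<Longrightarrow> dx = L / real K \<Longrightarrow>
       \<bar>resid dt dx K F (grid dt dx u) n k\<bar> \<le> mass dx K k * (c * (dx\<^sup>2 + dt\<^sup>2))"
    by (rule scheme_consistency[OF assms(1-5)]) (rule that)
  obtain F''' where F1: "\<And>x. (F has_real_derivative deriv F x) (at x)"
    and F2: "\<And>x. (deriv F has_real_derivative deriv (deriv F) x) (at x)"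
    and F3: "\<And>x. (deriv (deriv F) has_real_derivative F''' x) (at x)"
    by (rule C3_derivatives[OF assms(3)]) (rule that)
  have F2c: "continuous_on UNIV (deriv (deriv F))"
    using F3 by (meson DERIV_continuous_on has_field_derivative_at_within)
  \<comment> \<open>The constant has to be chosen before the grid and \<open>U\<close>, hence
    \<open>1 / B\<close> in place of the \<open>A\<close> introduced later. No sign of
    \<open>B\<close> is known yet; positivity follows once \<open>0 < dt < B\<close> is
    assumed.\<close>
  define Q where "Q = 32 / (1 / B) * (L + 2) * T * exp (14 * (1 / B) * T)"
  show ?thesis
    unfolding Let_def
  proof (intro exI[of _ "5 * (c * sqrt Q)"] allI impI)
    fix N K :: nat and U :: "nat \<Rightarrow> int \<Rightarrow> real"
    define dt dx where "dt = T / real N" and "dx = L / real K"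
    define v where "v = grid dt dx u"
    define e where "e = (\<lambda>n k. U n k - v n k)"
    define C1 where "C1 = Max ((\<lambda>n. max (norm_inf K (U n)) (norm_inf K (v n))) ` {0..N})"
    note defs = dt_def[symmetric] dx_def[symmetric] v_def[symmetric] e_def[symmetric] C1_def[symmetric]
    assume N: "N > 0" and K: "K > 0"
    assume "solves_scheme (T / real N) (L / real K) N K F U"
      and "\<forall>k\<in>{0..int K}. U 0 k = grid (T / real N) (L / real K) u 0 k
        \<and> U 1 k = grid (T / real N) (L / real K) u 1 k"
      and "B < 1 / (1 + maxabs (deriv (deriv F))
        (Max ((\<lambda>n. max (norm_inf K (U n)) (norm_inf K (grid (T / real N) (L / real K) u n))) ` {0..N})))"
      and "T / real N < B"
    then have scheme: "solves_scheme dt dx N K F U"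
      and init: "\<And>k. k \<in> {0..int K} \<Longrightarrow> U 0 k = v 0 k \<and> U 1 k = v 1 k"
      and B: "B < 1 / (1 + maxabs (deriv (deriv F)) C1)" and dtB: "dt < B"
      unfolding defs by blast+
    have dt: "dt > 0" and dx: "dx > 0" and NT: "real N * dt = T" and KL: "dx * real K = L"
      using N K assms by (auto simp: dt_def dx_def)
    have B0: "B > 0" using dt dtB by simp
    define A where "A = 1 / B"
    have A: "A > 0" "dt * A \<le> 1" using B0 dtB by (auto simp: A_def)
    \<comment> \<open>\<open>C1\<close> depends on the grid and on \<open>U\<close>, but the condition on \<open>B\<close> bounds \<open>F''\<close> uniformly\<close>
    have M: "maxabs (deriv (deriv F)) C1 \<le> A - 1"
    proof -
      have "1 + maxabs (deriv (deriv F)) C1 > 0"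
        using less_trans[OF B0 B] by simp
      then show ?thesis using B B0 by (simp add: A_def field_simps)
    qed
    have range: "\<bar>U n k\<bar> \<le> C1" "\<bar>v n k\<bar> \<le> C1" if "n \<le> N" "k \<in> {0..int K}" for n k
    proof -
      have "max (norm_inf K (U n)) (norm_inf K (v n)) \<le> C1"
        unfolding C1_def using that by (intro Max_ge) auto
      then show "\<bar>U n k\<bar> \<le> C1" "\<bar>v n k\<bar> \<le> C1"
        using abs_le_norm_inf[OF that(2), of "U n"] abs_le_norm_inf[OF that(2), of "v n"] by auto
    qed
    have bound: "norm_2 dx K (dn_minus dt e n) + norm_H1 dx K (e n)
        + \<bar>dn_minus dt e n 0\<bar> + \<bar>dn_minus dt e n (int K)\<bar> \<le> 5 * (c * sqrt Q) * (dx\<^sup>2 + dt\<^sup>2)"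
      if n: "n \<in> {1..N}" for n
    proof -
      have "energy dt dx K e n \<le> (c * (dx\<^sup>2 + dt\<^sup>2))\<^sup>2
          * (32 / A * (dx * real K + 2) * (real N * dt) * exp (14 * A * (real N * dt)))"
        unfolding e_def
      proof (rule energy_bound[OF A(1) dt dx K A(2) init _ _ _ n])
        fix m k assume m: "m \<in> {1..<N}" and k: "k \<in> {0..int K}"
        show "resid dt dx K F U m k = 0" by (rule solves_scheme_resid[OF scheme dx K m k])
        show "\<bar>resid dt dx K F v m k\<bar> \<le> mass dx K k * (c * (dx\<^sup>2 + dt\<^sup>2))"
          unfolding v_def by (rule c(2)[OF N K m k dt_def dx_def])
        have "\<bar>diff_quot F (U (m + 1) k) (U (m - 1) k) - diff_quot F (v (m + 1) k) (v (m - 1) k)\<bar>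
            \<le> maxabs (deriv (deriv F)) C1 / 2
              * (\<bar>U (m + 1) k - v (m + 1) k\<bar> + \<bar>U (m - 1) k - v (m - 1) k\<bar>)"
          using m k by (intro diff_quot_Lipschitz[OF F1 F2, where R = C1] maxabs_upper[OF F2c] range) auto
        also have "\<dots> \<le> (A - 1) / 2 * (\<bar>U (m + 1) k - v (m + 1) k\<bar> + \<bar>U (m - 1) k - v (m - 1) k\<bar>)"
          using M by (intro mult_right_mono) auto
        finally show "\<bar>diff_quot F (U (m + 1) k) (U (m - 1) k) - diff_quot F (v (m + 1) k) (v (m - 1) k)\<bar>
            \<le> (A - 1) / 2 * (\<bar>U (m + 1) k - v (m + 1) k\<bar> + \<bar>U (m - 1) k - v (m - 1) k\<bar>)" .
      qed
      then have "energy dt dx K e n \<le> (c * (dx\<^sup>2 + dt\<^sup>2))\<^sup>2 * Q"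
        by (simp only: NT KL Q_def A_def)
      \<comment> \<open>The energy is quadratic in the error, so the root of the squared truncation
        error yields the second order rate.\<close>
      then have "sqrt (energy dt dx K e n) \<le> sqrt ((c * (dx\<^sup>2 + dt\<^sup>2))\<^sup>2 * Q)"
        by (rule real_sqrt_le_mono)
      also have "\<dots> = c * sqrt Q * (dx\<^sup>2 + dt\<^sup>2)"
        using c(1) by (simp add: real_sqrt_mult abs_mult)
      finally show ?thesis using error_norm_le_energy[OF dx K, of dt e n] by simp
    qed
    have "Max ((\<lambda>n. norm_2 dx K (dn_minus dt e n) + norm_H1 dx K (e n)
        + \<bar>dn_minus dt e n 0\<bar> + \<bar>dn_minus dt e n (int K)\<bar>) ` {1..N}) \<le> 5 * (c * sqrt Q) * (dx\<^sup>2 + dt\<^sup>2)"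
      using N by (intro Max.boundedI) (auto intro: bound)
    then show "Max ((\<lambda>n. norm_2 (L / real K) K (dn_minus (T / real N)
            (\<lambda>n k. U n k - grid (T / real N) (L / real K) u n k) n)
          + norm_H1 (L / real K) K (\<lambda>k. U n k - grid (T / real N) (L / real K) u n k)
          + \<bar>dn_minus (T / real N) (\<lambda>n k. U n k - grid (T / real N) (L / real K) u n k) n 0\<bar>
          + \<bar>dn_minus (T / real N) (\<lambda>n k. U n k - grid (T / real N) (L / real K) u n k) n (int K)\<bar>) ` {1..N})
        \<le> 5 * (c * sqrt Q) * ((L / real K)\<^sup>2 + (T / real N)\<^sup>2)"
      unfolding e_def v_def dt_def dx_def .
  qed
qed

end
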